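(* For $a,b\ge2$, the walk on $G=\mathbb Z_a\times\mathbb Z_b$ with generating set $\{(\pm1,0),(0,\pm1)\}$ has spectral profile satisfying $$\Lambda(v) \asymp \begin{cases} 1/(vab) & 1/(ab) \leq v \leq a/b, \\ 1/(v^2 b^2) & a/b \leq v \leq 1, \\ 1/b^2 & 1 \leq v. \end{cases}$$ In particular, for the continuous-time walk $H_t$, $$d_{\infty,\pi}(H_t, \pi) \asymp \begin{cases} ab / (t+1) & 0 \leq t \leq a^2, \\ b/t^{1/2} & a^2 \leq t \leq b^2, \end{cases}$$ and there are constants $c_1, c_2 > 0$ such that for $t \geq b^2$ $$e^{-c_1t/b^2} \preceq d_{\infty, \pi}(H_t,\pi) \preceq e^{-c_2t/b^2}.$$ Here $c_1,c_2$ and all constants implicit in $\asymp$ and $\preceq$ are universal (independent of $a,b,v,t$).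
   Context: $a,b$ are integers. The walk has kernel $K(x,x+s)=1/|S|$ for $s\in S=\{(\pm1,0),(0,\pm1)\}\subset G$ (and $0$ otherwise); $\pi$ is uniform on $G$, so $\pi_*=\min_x\pi(x)=1/(ab)$. $H_t=e^{-t(I-K)}$ has kernel $H_t(x,y)=e^{-t}\sum_{k\ge0}\frac{t^k}{k!}K^k(x,y)$, and $d_{\infty,\pi}(H_t,\pi)=\sup_{x,y\in G}\left|\frac{H_t(x,y)}{\pi(y)}-1\right|$. The spectral profile is $$\Lambda(r)=\inf_{\pi_*\le\pi(S)\le r}\ \inf_{f\in c_0^+(S)}\frac{\mathcal E(f,f)}{\mathrm{Var}(f)},\qquad r\ge\pi_*,$$ the outer infimum being over subsets $S\subset G$, where $\mathcal E(f,g)=\langle(I-K)f,g\rangle_\pi=\sum_x((I-K)f)(x)g(x)\pi(x)$, $\mathrm{Var}$ is the variance with respect to $\pi$, and $c_0^+(S)$ is the set of non-constant functions $f\ge0$ on $G$ with support contained in $S$. $f\preceq g$ means $f\le Cg$ for a constant $C>0$, and $f\asymp g$ means $f\preceq g$ and $g\preceq f$.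
   Formalization: The formal theorem assumes a ≤ b in addition to a, b ≥ 2; without it the cases contradict each other (for b = 2, v = 1, a → ∞ the first gives 1/(2a), the third 1/4). *)

theory Defs
  imports "HOL-Probability.Probability" "HOL-Algebra.Elementary_Groups"
begin

section \<open>Finite Markov kernels\<close>

text \<open>A kernel is a function \<open>K\<close> on a finite state space \<open>V\<close>. Only values on \<open>V\<close> matter.
  The reference distribution \<open>p\<close> plays the role of \<open>\<pi>\<close>.\<close>

primrec kernel_pow :: "'v set \<Rightarrow> ('v \<Rightarrow> 'v \<Rightarrow> real) \<Rightarrow> nat \<Rightarrow> 'v \<Rightarrow> 'v \<Rightarrow> real" where
  "kernel_pow V K 0 x y = (if x = y then 1 else 0)"
| "kernel_pow V K (Suc k) x y = (\<Sum>z\<in>V. K x z * kernel_pow V K k z y)"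

definition heat_kernel :: "'v set \<Rightarrow> ('v \<Rightarrow> 'v \<Rightarrow> real) \<Rightarrow> real \<Rightarrow> 'v \<Rightarrow> 'v \<Rightarrow> real" where
  "heat_kernel V K t x y = exp (- t) * (\<Sum>k. t ^ k / fact k * kernel_pow V K k x y)"

definition d_infinity :: "'v set \<Rightarrow> ('v \<Rightarrow> 'v \<Rightarrow> real) \<Rightarrow> 'v pmf \<Rightarrow> real" where
  "d_infinity V H p = (SUP (x, y) \<in> V \<times> V. \<bar>H x y / pmf p y - 1\<bar>)"

definition dirichlet_form ::
    "'v set \<Rightarrow> ('v \<Rightarrow> 'v \<Rightarrow> real) \<Rightarrow> 'v pmf \<Rightarrow> ('v \<Rightarrow> real) \<Rightarrow> ('v \<Rightarrow> real) \<Rightarrow> real" where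
  "dirichlet_form V K p f g = (\<Sum>x\<in>V. (f x - (\<Sum>y\<in>V. K x y * f y)) * g x * pmf p x)"

definition c0_plus :: "'v set \<Rightarrow> 'v set \<Rightarrow> ('v \<Rightarrow> real) set" where
  "c0_plus V S = {f. (\<forall>x\<in>V. 0 \<le> f x) \<and> {x \<in> V. f x \<noteq> 0} \<subseteq> S \<and> \<not> f constant_on V}"

definition spectral_profile ::
    "'v set \<Rightarrow> ('v \<Rightarrow> 'v \<Rightarrow> real) \<Rightarrow> 'v pmf \<Rightarrow> real \<Rightarrow> real" where
  "spectral_profile V K p r =
     (INF S \<in> {S. S \<subseteq> V \<and> Min (pmf p ` V) \<le> measure_pmf.prob p S \<and> measure_pmf.prob p S \<le> r}.
        INF f \<in> c0_plus V S. dirichlet_form V K p f f / measure_pmf.variance p f)"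

section \<open>The walk on the discrete torus\<close>

definition walk_kernel :: "('g, 'm) monoid_scheme \<Rightarrow> 'g set \<Rightarrow> 'g \<Rightarrow> 'g \<Rightarrow> real" where
  "walk_kernel G S x y = (if \<exists>s\<in>S. y = x \<otimes>\<^bsub>G\<^esub> s then 1 / real (card S) else 0)"

definition torus :: "nat \<Rightarrow> nat \<Rightarrow> (int \<times> int) monoid" where
  "torus a b = integer_mod_group a \<times>\<times> integer_mod_group b"

text \<open>The generators form a set: if \<open>a = 2\<close>, then \<open>(1, 0)\<close> and \<open>(-1, 0)\<close> coincide and are
  counted once (and likewise for \<open>b = 2\<close>).\<close>

definition torus_gens :: "nat \<Rightarrow> nat \<Rightarrow> (int \<times> int) set" where
  "torus_gens a b =
     (\<lambda>(x, y). (x mod int a, y mod int b)) ` {(1, 0), (-1, 0), (0, 1), (0, -1)}"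

definition torus_kernel :: "nat \<Rightarrow> nat \<Rightarrow> int \<times> int \<Rightarrow> int \<times> int \<Rightarrow> real" where
  "torus_kernel a b = walk_kernel (torus a b) (torus_gens a b)"

definition torus_pi :: "nat \<Rightarrow> nat \<Rightarrow> (int \<times> int) pmf" where
  "torus_pi a b = pmf_of_set (carrier (torus a b))"

definition torus_profile :: "nat \<Rightarrow> nat \<Rightarrow> real \<Rightarrow> real" where
  "torus_profile a b = spectral_profile (carrier (torus a b)) (torus_kernel a b) (torus_pi a b)"

definition torus_dist :: "nat \<Rightarrow> nat \<Rightarrow> real \<Rightarrow> real" where
  "torus_dist a b t =
     d_infinity (carrier (torus a b)) (heat_kernel (carrier (torus a b)) (torus_kernel a b) t)
       (torus_pi a b)"

section \<open>Comparison up to a universal constant\<close>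

text \<open>The index set \<open>I\<close> collects all parameters over which the constant is uniform.\<close>

definition preceq_on :: "'i set \<Rightarrow> ('i \<Rightarrow> real) \<Rightarrow> ('i \<Rightarrow> real) \<Rightarrow> bool" where
  "preceq_on I f g \<longleftrightarrow> (\<exists>C>0. \<forall>i\<in>I. f i \<le> C * g i)"

definition comparable_on :: "'i set \<Rightarrow> ('i \<Rightarrow> real) \<Rightarrow> ('i \<Rightarrow> real) \<Rightarrow> bool" where
  "comparable_on I f g \<longleftrightarrow> preceq_on I f g \<and> preceq_on I g f"

end

theory Submission imports Defs
begin

text \<open>Write \<open>K\<^sub>n\<close> for the walk with steps \<open>\<plusminus>1\<close> on the cycle of length \<open>n\<close>. The walk on the torus
  satisfies \<open>I - K = p (I - K\<^sub>a) + q (I - K\<^sub>b)\<close>, each summand acting on one coordinate, where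
  \<open>p + q = 1\<close> and \<open>p, q \<ge> 1/3\<close>; the weights are \<open>1/2\<close> unless exactly one side has length
  \<open>2\<close>, in which case the two steps along that side are a single generator. The characters of the
  torus diagonalise \<open>K\<close>, with \<open>1 - \<kappa>(j, k) = p (1 - cos (2\<pi>j/a)) + q (1 - cos (2\<pi>k/b))\<close>, and so
  everything is governed by the heat trace of a cycle,
  \<open>F\<^sub>n(s) = \<Sum>\<^sub>k exp (- s (1 - cos (2\<pi>k/n)))\<close>.

  \<^emph>\<open>Distance.\<close> In the spectral expansion of \<open>H\<^sub>t(x, y)/\<pi>(y) - 1\<close> all characters have modulus \<open>1\<close>
  and are aligned on the diagonal, so the supremum is attained there and equals
  \<open>F\<^sub>a(pt) F\<^sub>b(qt) - 1\<close> exactly (lemma \<open>torus_dist_eq\<close>). Since \<open>1 - cos (2\<pi>k/n)\<close> is comparable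
  with \<open>k\<^sup>2/n\<^sup>2\<close> for \<open>k \<le> n/2\<close>, the trace is comparable with a Gaussian sum:
  \<open>F\<^sub>n(s) - 1\<close> is of order \<open>n/\<surd>(s + 1)\<close> for \<open>s \<le> n\<^sup>2\<close> and decays exponentially in \<open>s/n\<^sup>2\<close> after
  that. The three time regimes come from the position of \<open>t\<close> relative to \<open>a\<^sup>2\<close> and \<open>b\<^sup>2\<close>.

  \<^emph>\<open>Lower bound for the profile.\<close> Integrating \<open>1 \<le> exp (- t \<lambda>) + t \<lambda>\<close> against the spectral
  measure of \<open>f\<close>, whose atoms are at most \<open>\<parallel>f\<parallel>\<^sub>1\<^sup>2\<close>, gives a Nash inequality
  \<open>\<parallel>f\<parallel>\<^sub>2\<^sup>2 \<le> F\<^sub>a(pt) F\<^sub>b(qt) \<parallel>f\<parallel>\<^sub>1\<^sup>2 + t \<E>(f, f)\<close> (lemma \<open>nash_inequality\<close>). A function supported in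
  \<open>S\<close> has \<open>\<parallel>f\<parallel>\<^sub>1\<^sup>2 \<le> \<pi>(S) \<parallel>f\<parallel>\<^sub>2\<^sup>2\<close>, so as soon as \<open>F\<^sub>a(pt) F\<^sub>b(qt) \<pi>(S) \<le> 1/2\<close> the first term is
  absorbed and \<open>\<E>(f, f)/Var(f) \<ge> 1/(2t)\<close>. The right time is \<open>t = C \<rho>\<^sup>2\<close> with \<open>\<rho>\<close> the radius of a
  ball of volume \<open>v\<close>: \<open>\<rho>\<^sup>2 = v a b\<close> while \<open>\<rho> \<le> a\<close>, and \<open>\<rho> = v b\<close> once the ball wraps around the
  short side. Once \<open>v\<close> exceeds a fixed constant, the spectral gap, which is at least \<open>1/b\<^sup>2\<close>, is
  enough.

  \<^emph>\<open>Upper bound for the profile.\<close> The Dirichlet eigenfunction \<open>sin (\<pi>(x + 1)/(r + 1))\<close> of an interval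
  of length \<open>r\<close> (lemma \<open>sine_bump_superharmonic\<close>) satisfies \<open>f - K f \<le> \<delta> f\<close> with \<open>\<delta>\<close> of order
  \<open>1/r\<^sup>2\<close>. Its product over both sides, supported in a square of side about \<open>\<rho>/2\<close>, respectively the
  same bump on the long side alone, supported in a strip, gives the matching test functions. If the
  support has mass at most \<open>1/2\<close>, then the variance is at least half of the second moment, and
  \<open>\<E>(f, f)/Var(f) \<le> 2\<delta>\<close>.\<close>

section \<open>Energy, variance and spectral profile for a uniform distribution\<close>

lemma variance_uniform:
  fixes f :: "'v \<Rightarrow> real"
  assumes "finite V" "V \<noteq> {}"
  shows "measure_pmf.variance (pmf_of_set V) f
    = (\<Sum>x\<in>V. (f x)\<^sup>2) / card V - ((\<Sum>x\<in>V. f x) / card V)\<^sup>2"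
proof -
  have int: "integrable (measure_pmf (pmf_of_set V)) g" for g :: "'v \<Rightarrow> real"
    using assms by (intro integrable_measure_pmf_finite) simp
  show ?thesis
    using assms
    by (subst measure_pmf.variance_eq) (auto simp: int integral_pmf_of_set)
qed

lemma dirichlet_form_uniform:
  assumes "finite V" "V \<noteq> {}"
  shows "dirichlet_form V K (pmf_of_set V) f f
    = (\<Sum>x\<in>V. (f x - (\<Sum>y\<in>V. K x y * f y)) * f x) / card V"
  unfolding dirichlet_form_def using assms
  by (simp add: sum_divide_distrib)

text \<open>Cauchy-Schwarz against the indicator function of \<open>S\<close>: a function with small support has small
  \<open>1\<close>-norm compared with its \<open>2\<close>-norm. This is how the volume of the support enters the profile.\<close>

lemma sum_squared_le_card_support:
  fixes f :: "'v \<Rightarrow> real"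
  assumes "finite V" "S \<subseteq> V" "{x \<in> V. f x \<noteq> 0} \<subseteq> S"
  shows "(\<Sum>x\<in>V. f x)\<^sup>2 \<le> card S * (\<Sum>x\<in>V. (f x)\<^sup>2)"
proof -
  have fin: "finite S" using assms finite_subset by blast
  have "(\<Sum>x\<in>V. f x) = (\<Sum>x\<in>S. 1 * f x)"
    using assms by (simp, intro sum.mono_neutral_right) auto
  also have "\<dots>\<^sup>2 \<le> (\<Sum>x\<in>S. 1\<^sup>2) * (\<Sum>x\<in>S. (f x)\<^sup>2)"
    by (rule Cauchy_Schwarz_ineq_sum)
  also have "(\<Sum>x\<in>S. (f x)\<^sup>2) = (\<Sum>x\<in>V. (f x)\<^sup>2)"
    using assms by (intro sum.mono_neutral_left) auto
  finally show ?thesis by simp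
qed

lemma variance_uniform_pos:
  fixes f :: "'v \<Rightarrow> real"
  assumes "finite V" "V \<noteq> {}" "\<not> f constant_on V"
  shows "measure_pmf.variance (pmf_of_set V) f > 0"
proof -
  let ?\<mu> = "measure_pmf.expectation (pmf_of_set V) f"
  obtain x where x: "x \<in> V" "f x \<noteq> ?\<mu>"
    using assms(3) unfolding constant_on_def by blast
  have "0 < (f x - ?\<mu>)\<^sup>2" using x by simp
  also have "\<dots> \<le> (\<Sum>x\<in>V. (f x - ?\<mu>)\<^sup>2)"
    using x assms by (intro member_le_sum) auto
  finally show ?thesis
    using assms by (subst integral_pmf_of_set) (auto simp: card_gt_0_iff)
qed

text \<open>The least mass of a point is \<open>1 / card V\<close>, so the lower bound on \<open>\<pi>(S)\<close> in the spectral profile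
  only excludes the empty set.\<close>

lemma admissible_sets_uniform:
  fixes r :: real
  assumes "finite V" "V \<noteq> {}"
  shows "{S. S \<subseteq> V \<and> Min (pmf (pmf_of_set V) ` V) \<le> measure_pmf.prob (pmf_of_set V) S
      \<and> measure_pmf.prob (pmf_of_set V) S \<le> r}
    = {S. S \<subseteq> V \<and> S \<noteq> {} \<and> card S \<le> r * card V}"
proof -
  have N: "real (card V) > 0" using assms by (simp add: card_gt_0_iff)
  have "pmf (pmf_of_set V) ` V = {1 / card V}" using assms by auto
  then have min: "Min (pmf (pmf_of_set V) ` V) = 1 / card V" by simp
  have prob: "measure_pmf.prob (pmf_of_set V) S = card S / card V" if "S \<subseteq> V" for S
    using assms that by (simp add: measure_pmf_of_set Int_absorb1)
  have 1: "1 / card V \<le> card S / card V \<longleftrightarrow> S \<noteq> {}" if "S \<subseteq> V" for S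
    using N that finite_subset[OF that assms(1)] by (simp add: divide_le_cancel card_gt_0_iff Suc_le_eq)
  have 2: "card S / card V \<le> r \<longleftrightarrow> card S \<le> r * card V" for S :: "'a set"
    using N by (simp add: divide_le_eq)
  show ?thesis
    by (intro Collect_cong conj_cong refl) (simp_all only: min prob 1 2)
qed

lemma c0_plus_nonempty:
  assumes "finite V" "card V \<ge> 2" "S \<subseteq> V" "S \<noteq> {}"
  shows "c0_plus V S \<noteq> {}"
proof -
  obtain x where x: "x \<in> S" using assms by blast
  have "\<not> V \<subseteq> {x}"
    using assms(2) card_mono[of "{x}" V] by auto
  then obtain y where y: "y \<in> V" "y \<noteq> x" by blast
  have "\<not> (\<lambda>z. if z = x then 1 else 0 :: real) constant_on V"
    using x y assms(3) unfolding constant_on_def by (metis subsetD zero_neq_one)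
  then have "(\<lambda>z. if z = x then 1 else 0) \<in> c0_plus V S"
    using x by (auto simp: c0_plus_def)
  then show ?thesis by blast
qed

text \<open>Infima over empty sets have an unspecified real value. The bound on \<open>r\<close> makes singletons
  admissible, and \<open>card V \<ge> 2\<close> provides a non-constant function on every admissible set.\<close>

lemma spectral_profile_uniform_ge:
  fixes r :: real
  assumes V: "finite V" "card V \<ge> 2" and r: "1 \<le> r * card V"
    and le: "\<And>S f. S \<subseteq> V \<Longrightarrow> card S \<le> r * card V \<Longrightarrow> f \<in> c0_plus V S \<Longrightarrow>
      m * measure_pmf.variance (pmf_of_set V) f \<le> dirichlet_form V K (pmf_of_set V) f f"
  shows "m \<le> spectral_profile V K (pmf_of_set V) r"
proof -
  have ne: "V \<noteq> {}" using V by auto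
  then obtain x where "x \<in> V" by blast
  then have "{x} \<in> {S. S \<subseteq> V \<and> S \<noteq> {} \<and> card S \<le> r * card V}" using r by simp
  then have nonempty: "{S. S \<subseteq> V \<and> S \<noteq> {} \<and> card S \<le> r * card V} \<noteq> {}" by blast
  show ?thesis
    unfolding spectral_profile_def admissible_sets_uniform[OF V(1) ne]
  proof (intro cINF_greatest nonempty)
    fix S assume "S \<in> {S. S \<subseteq> V \<and> S \<noteq> {} \<and> card S \<le> r * card V}"
    then show "c0_plus V S \<noteq> {}" by (intro c0_plus_nonempty V) auto
  next
    fix S f assume "S \<in> {S. S \<subseteq> V \<and> S \<noteq> {} \<and> card S \<le> r * card V}" and f: "f \<in> c0_plus V S"
    then have "m * measure_pmf.variance (pmf_of_set V) f \<le> dirichlet_form V K (pmf_of_set V) f f"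
      by (intro le) auto
    moreover have "measure_pmf.variance (pmf_of_set V) f > 0"
      using f by (intro variance_uniform_pos V ne) (simp add: c0_plus_def)
    ultimately show "m \<le> dirichlet_form V K (pmf_of_set V) f f / measure_pmf.variance (pmf_of_set V) f"
      by (simp add: le_divide_eq)
  qed
qed

lemma spectral_profile_uniform_le:
  fixes r :: real
  assumes V: "finite V" "card V \<ge> 2"
    and nonneg: "\<And>f. dirichlet_form V K (pmf_of_set V) f f \<ge> 0"
    and S: "S \<subseteq> V" "S \<noteq> {}" "card S \<le> r * card V" and f: "f \<in> c0_plus V S"
    and le: "dirichlet_form V K (pmf_of_set V) f f \<le> m * measure_pmf.variance (pmf_of_set V) f"
  shows "spectral_profile V K (pmf_of_set V) r \<le> m"
proof -
  have ne: "V \<noteq> {}" using V by auto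
  let ?q = "\<lambda>f. dirichlet_form V K (pmf_of_set V) f f / measure_pmf.variance (pmf_of_set V) f"
  have q: "0 \<le> ?q g" for g
    by (intro divide_nonneg_nonneg nonneg) simp
  have bdd: "bdd_below (?q ` A)" for A
    using q by (intro bdd_belowI2[of _ 0]) auto
  have "(INF S \<in> {S. S \<subseteq> V \<and> S \<noteq> {} \<and> card S \<le> r * card V}. INF f \<in> c0_plus V S. ?q f) \<le> (INF f \<in> c0_plus V S. ?q f)"
  proof (intro cINF_lower bdd_belowI2[of _ 0])
    fix T assume "T \<in> {S. S \<subseteq> V \<and> S \<noteq> {} \<and> card S \<le> r * card V}"
    then show "0 \<le> (INF f \<in> c0_plus V T. ?q f)"
      by (intro cINF_greatest c0_plus_nonempty V q) auto
  qed (use S in auto)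
  also have "\<dots> \<le> ?q f" by (intro cINF_lower bdd f)
  also have "\<dots> \<le> m"
    using le variance_uniform_pos[OF V(1) ne] f by (simp add: divide_le_eq c0_plus_def)
  finally show ?thesis
    unfolding spectral_profile_def admissible_sets_uniform[OF V(1) ne] .
qed

text \<open>A supersolution \<open>f - K f \<le> \<delta> f\<close> bounds the energy by \<open>\<delta>\<close> times the second moment at once, so
  neither the normalisation of \<open>f\<close> nor its discrete gradient has to be computed. Because \<open>S\<close> fills at
  most half of the space, \<open>sum_squared_le_card_support\<close> shows that the squared mean is at most half
  of the second moment; this is the factor \<open>2\<close>.\<close>

lemma spectral_profile_superharmonic_le:
  fixes r :: real
  assumes V: "finite V" "card V \<ge> 2"
    and nonneg: "\<And>f. dirichlet_form V K (pmf_of_set V) f f \<ge> 0"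
    and S: "S \<subseteq> V" "card S \<le> r * card V" "card S \<le> card V / 2"
    and f: "\<And>x. x \<in> V \<Longrightarrow> f x \<ge> 0" "{x \<in> V. f x \<noteq> 0} \<subseteq> S" "z \<in> V" "f z \<noteq> 0"
    and super: "\<And>x. x \<in> V \<Longrightarrow> f x - (\<Sum>y\<in>V. K x y * f y) \<le> \<delta> * f x"
  shows "spectral_profile V K (pmf_of_set V) r \<le> 2 * \<delta>"
proof (rule spectral_profile_uniform_le[OF V nonneg S(1)])
  have ne: "V \<noteq> {}" using V by auto
  define N where "N = real (card V)"
  have N: "N > 0" using V by (simp add: N_def)
  define Q where "Q = (\<Sum>x\<in>V. (f x)\<^sup>2)"
  have "S \<noteq> V" using S(3) N by (auto simp: N_def)
  then obtain w where w: "w \<in> V" "w \<notin> S" using S(1) by blast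
  then have "f w = 0" using f(2) by blast
  then have "\<not> f constant_on V"
    using f(3,4) w(1) unfolding constant_on_def by metis
  then show "f \<in> c0_plus V S" using f(1,2) by (simp add: c0_plus_def)
  have "0 < (f z)\<^sup>2" using f(4) by simp
  also have "\<dots> \<le> Q" unfolding Q_def using V f(3) by (intro member_le_sum) auto
  finally have Q: "Q > 0" .
  have "dirichlet_form V K (pmf_of_set V) f f \<le> (\<Sum>x\<in>V. \<delta> * f x * f x) / N"
    unfolding dirichlet_form_uniform[OF V(1) ne] N_def
    using super f(1) by (intro divide_right_mono sum_mono mult_right_mono) auto
  also have "\<dots> = \<delta> * (Q / N)"
    by (simp add: Q_def sum_distrib_left power2_eq_square mult.assoc)
  finally have E: "dirichlet_form V K (pmf_of_set V) f f \<le> \<delta> * (Q / N)" .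
  then have "0 \<le> \<delta> * (Q / N)" using nonneg[of f] by linarith
  then have \<delta>: "\<delta> \<ge> 0" using Q N by (simp add: zero_le_mult_iff zero_le_divide_iff)
  have "(\<Sum>x\<in>V. f x)\<^sup>2 \<le> card S * Q"
    unfolding Q_def by (rule sum_squared_le_card_support[OF V(1) S(1) f(2)])
  also have "\<dots> \<le> (N / 2) * Q" using S(3) Q by (intro mult_right_mono) (auto simp: N_def)
  finally have "(\<Sum>x\<in>V. f x)\<^sup>2 / N\<^sup>2 \<le> (N / 2) * Q / N\<^sup>2" by (intro divide_right_mono) auto
  then have "((\<Sum>x\<in>V. f x) / N)\<^sup>2 \<le> (Q / N) / 2"
    using N by (simp add: power_divide power2_eq_square)
  then have "Q / N \<le> 2 * measure_pmf.variance (pmf_of_set V) f"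
    unfolding variance_uniform[OF V(1) ne] Q_def N_def by simp
  then have "\<delta> * (Q / N) \<le> \<delta> * (2 * measure_pmf.variance (pmf_of_set V) f)"
    using \<delta> by (intro mult_left_mono)
  then show "dirichlet_form V K (pmf_of_set V) f f \<le> 2 * \<delta> * measure_pmf.variance (pmf_of_set V) f"
    using E by simp
qed (use S f in auto)

section \<open>Chains with a unimodular eigenbasis\<close>

text \<open>A chain with a uniform stationary distribution that is diagonalised by functions of modulus \<open>1\<close>,
  such as a symmetric random walk on a finite abelian group. Orthonormality of the eigenbasis is
  expressed by the completeness relation, which for real eigenvalues forces the kernel to be
  symmetric.\<close>

locale unimodular_eigenbasis =
  fixes V :: "'v set" and K :: "'v \<Rightarrow> 'v \<Rightarrow> real"
    and X :: "'k set" and \<psi> :: "'k \<Rightarrow> 'v \<Rightarrow> complex" and \<kappa> :: "'k \<Rightarrow> real" and \<xi>\<^sub>0 :: 'k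
  assumes finite_V: "finite V" and V_nonempty: "V \<noteq> {}" and finite_X: "finite X"
    and norm_psi: "\<And>\<xi> x. \<xi> \<in> X \<Longrightarrow> x \<in> V \<Longrightarrow> cmod (\<psi> \<xi> x) = 1"
    and completeness: "\<And>x y. x \<in> V \<Longrightarrow> y \<in> V \<Longrightarrow>
      (\<Sum>\<xi>\<in>X. \<psi> \<xi> x * cnj (\<psi> \<xi> y)) = (if x = y then of_nat (card V) else 0)"
    and eigen: "\<And>\<xi> x. \<xi> \<in> X \<Longrightarrow> x \<in> V \<Longrightarrow>
      (\<Sum>y\<in>V. of_real (K x y) * \<psi> \<xi> y) = of_real (\<kappa> \<xi>) * \<psi> \<xi> x"
    and trivial_in: "\<xi>\<^sub>0 \<in> X" and trivial_psi: "\<And>x. x \<in> V \<Longrightarrow> \<psi> \<xi>\<^sub>0 x = 1"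
    and trivial_kappa: "\<kappa> \<xi>\<^sub>0 = 1"
begin

lemma card_V_pos: "real (card V) > 0"
  using finite_V V_nonempty by (simp add: card_gt_0_iff)

lemma psi_cnj_psi [simp]: "\<xi> \<in> X \<Longrightarrow> x \<in> V \<Longrightarrow> \<psi> \<xi> x * cnj (\<psi> \<xi> x) = 1"
  by (simp add: complex_norm_square[symmetric] norm_psi)

lemma kernel_pow_spectral:
  assumes "x \<in> V" "y \<in> V"
  shows "of_real (kernel_pow V K k x y)
    = (\<Sum>\<xi>\<in>X. of_real (\<kappa> \<xi> ^ k) * (\<psi> \<xi> x * cnj (\<psi> \<xi> y))) / of_nat (card V)"
  using assms(1)
proof (induction k arbitrary: x)
  case 0
  show ?case using completeness[OF 0 assms(2)] card_V_pos by simp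
next
  case (Suc k)
  have "of_real (kernel_pow V K (Suc k) x y)
      = (\<Sum>z\<in>V. \<Sum>\<xi>\<in>X. of_real (\<kappa> \<xi> ^ k) * (of_real (K x z) * \<psi> \<xi> z * cnj (\<psi> \<xi> y))) / of_nat (card V)"
    by (simp add: Suc.IH sum_divide_distrib sum_distrib_left mult_ac)
  also have "\<dots> = (\<Sum>\<xi>\<in>X. of_real (\<kappa> \<xi> ^ k) * ((\<Sum>z\<in>V. of_real (K x z) * \<psi> \<xi> z) * cnj (\<psi> \<xi> y))) / of_nat (card V)"
    by (subst sum.swap) (simp add: sum_distrib_left sum_distrib_right)
  also have "\<dots> = (\<Sum>\<xi>\<in>X. of_real (\<kappa> \<xi> ^ Suc k) * (\<psi> \<xi> x * cnj (\<psi> \<xi> y))) / of_nat (card V)"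
    by (intro arg_cong2[where f = "(/)"] sum.cong refl) (simp only: eigen[OF _ Suc.prems], simp add: mult_ac)
  finally show ?case .
qed

lemma kernel_spectral:
  assumes "x \<in> V" "y \<in> V"
  shows "of_real (K x y) = (\<Sum>\<xi>\<in>X. of_real (\<kappa> \<xi>) * (\<psi> \<xi> x * cnj (\<psi> \<xi> y))) / of_nat (card V)"
proof -
  have "kernel_pow V K (Suc 0) x y = K x y"
    using assms finite_V by (simp add: sum.delta' if_distrib cong: if_cong)
  then show ?thesis using kernel_pow_spectral[OF assms, of "Suc 0"] by simp
qed

text \<open>Exchange the exponential series in \<open>t\<close> with the finite sum over the spectrum, and use
  \<open>exp (- t) exp (t \<kappa>) = exp (- t (1 - \<kappa>))\<close>.\<close>

lemma heat_kernel_spectral: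
  assumes "x \<in> V" "y \<in> V"
  shows "of_real (heat_kernel V K t x y)
    = (\<Sum>\<xi>\<in>X. of_real (exp (- t * (1 - \<kappa> \<xi>))) * (\<psi> \<xi> x * cnj (\<psi> \<xi> y))) / of_nat (card V)"
proof -
  let ?w = "\<lambda>\<xi>. \<psi> \<xi> x * cnj (\<psi> \<xi> y)"
  have ex: "(\<lambda>k. t ^ k / fact k * \<kappa> \<xi> ^ k) sums exp (t * \<kappa> \<xi>)" for \<xi>
    using exp_converges[of "t * \<kappa> \<xi>"]
    by (simp add: field_simps power_mult_distrib)
  have "(\<lambda>k. of_real (t ^ k / fact k * \<kappa> \<xi> ^ k) * ?w \<xi>) sums (of_real (exp (t * \<kappa> \<xi>)) * ?w \<xi>)" for \<xi>
    by (intro sums_mult2 sums_of_real ex)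
  then have "(\<lambda>k. (\<Sum>\<xi>\<in>X. of_real (t ^ k / fact k * \<kappa> \<xi> ^ k) * ?w \<xi>) / of_nat (card V)) sums
      ((\<Sum>\<xi>\<in>X. of_real (exp (t * \<kappa> \<xi>)) * ?w \<xi>) / of_nat (card V))"
    by (intro sums_divide sums_sum)
  moreover have "(\<lambda>k. (\<Sum>\<xi>\<in>X. of_real (t ^ k / fact k * \<kappa> \<xi> ^ k) * ?w \<xi>) / of_nat (card V))
      = (\<lambda>k. of_real (t ^ k / fact k * kernel_pow V K k x y))"
    by (simp add: kernel_pow_spectral[OF assms] sum_distrib_left sum_divide_distrib mult_ac fun_eq_iff)
  ultimately have s: "(\<lambda>k. of_real (t ^ k / fact k * kernel_pow V K k x y)) sums
      ((\<Sum>\<xi>\<in>X. of_real (exp (t * \<kappa> \<xi>)) * ?w \<xi>) / of_nat (card V))"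
    by simp
  then have sm: "summable (\<lambda>k. t ^ k / fact k * kernel_pow V K k x y)"
    using summable_complex_of_real sums_summable by blast
  have "of_real (\<Sum>k. t ^ k / fact k * kernel_pow V K k x y)
      = ((\<Sum>\<xi>\<in>X. of_real (exp (t * \<kappa> \<xi>)) * ?w \<xi>) / of_nat (card V))"
    using sums_unique2[OF sums_of_real[OF summable_sums[OF sm]] s] .
  then have "of_real (heat_kernel V K t x y) =
      (\<Sum>\<xi>\<in>X. of_real (exp (- t)) * (of_real (exp (t * \<kappa> \<xi>)) * ?w \<xi>)) / of_nat (card V)"
    unfolding heat_kernel_def of_real_mult by (simp add: sum_distrib_left)
  also have "\<dots> = (\<Sum>\<xi>\<in>X. of_real (exp (- t * (1 - \<kappa> \<xi>))) * ?w \<xi>) / of_nat (card V)"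
    unfolding mult.assoc[symmetric] of_real_mult[symmetric] exp_add[symmetric]
    by (simp add: algebra_simps)
  finally show ?thesis .
qed

text \<open>The triangle inequality bounds every \<open>\<bar>H\<^sub>t(x, y)/\<pi>(y) - 1\<bar>\<close> by the sum of the non-trivial
  exponentials. On the diagonal each \<open>\<psi> \<xi> x * cnj (\<psi> \<xi> x)\<close> equals \<open>1\<close>, so the bound is attained.\<close>

lemma d_infinity_spectral:
  "d_infinity V (heat_kernel V K t) (pmf_of_set V) = (\<Sum>\<xi>\<in>X - {\<xi>\<^sub>0}. exp (- t * (1 - \<kappa> \<xi>)))"
  (is "_ = ?D")
proof -
  let ?h = "\<lambda>x y. heat_kernel V K t x y / pmf (pmf_of_set V) y - 1"
  have h: "of_real (?h x y) = (\<Sum>\<xi>\<in>X - {\<xi>\<^sub>0}. of_real (exp (- t * (1 - \<kappa> \<xi>))) * (\<psi> \<xi> x * cnj (\<psi> \<xi> y)))"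
    if "x \<in> V" "y \<in> V" for x y
  proof -
    have "of_real (?h x y) = of_real (heat_kernel V K t x y) * of_nat (card V) - (1 :: complex)"
      using that finite_V V_nonempty by simp
    also have "\<dots> = (\<Sum>\<xi>\<in>X. of_real (exp (- t * (1 - \<kappa> \<xi>))) * (\<psi> \<xi> x * cnj (\<psi> \<xi> y))) - 1"
      unfolding heat_kernel_spectral[OF that] using card_V_pos by simp
    also have "\<dots> = (\<Sum>\<xi>\<in>X - {\<xi>\<^sub>0}. of_real (exp (- t * (1 - \<kappa> \<xi>))) * (\<psi> \<xi> x * cnj (\<psi> \<xi> y)))"
      using that finite_X trivial_in by (subst sum.remove[of X \<xi>\<^sub>0]) (auto simp: trivial_psi trivial_kappa)
    finally show ?thesis .
  qed
  obtain x0 where x0: "x0 \<in> V" using V_nonempty by blast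
  have "?D \<in> (\<lambda>(x, y). \<bar>?h x y\<bar>) ` (V \<times> V)"
  proof -
    have "complex_of_real (?h x0 x0) = of_real ?D"
      unfolding h[OF x0 x0] using x0 by simp
    then have "?h x0 x0 = ?D" by (simp only: of_real_eq_iff)
    then have "\<bar>?h x0 x0\<bar> = ?D" by (simp add: sum_nonneg)
    then show ?thesis using x0 by (intro image_eqI[of _ _ "(x0, x0)"]) auto
  qed
  moreover have "\<bar>?h x y\<bar> \<le> ?D" if "x \<in> V" "y \<in> V" for x y
  proof -
    have "\<bar>?h x y\<bar> = cmod (of_real (?h x y))" by (simp only: norm_of_real)
    also have "\<dots> \<le> (\<Sum>\<xi>\<in>X - {\<xi>\<^sub>0}. cmod (of_real (exp (- t * (1 - \<kappa> \<xi>))) * (\<psi> \<xi> x * cnj (\<psi> \<xi> y))))"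
      unfolding h[OF that] by (rule norm_sum)
    also have "\<dots> = ?D"
      using that by (simp add: norm_mult norm_psi)
    finally show ?thesis .
  qed
  ultimately show ?thesis
    unfolding d_infinity_def by (intro cSup_eq_maximum) auto
qed

definition transform :: "('v \<Rightarrow> real) \<Rightarrow> 'k \<Rightarrow> complex" where
  "transform f \<xi> = (\<Sum>x\<in>V. of_real (f x) * \<psi> \<xi> x)"

text \<open>The functional calculus behind Parseval's identity (\<open>\<phi> = 1\<close>) and the spectral formula for the
  energy (\<open>\<phi> = \<kappa>\<close>).\<close>

lemma quadratic_form_spectral:
  fixes M :: "'v \<Rightarrow> 'v \<Rightarrow> real" and f :: "'v \<Rightarrow> real" and \<phi> :: "'k \<Rightarrow> real"
  assumes "\<And>x y. x \<in> V \<Longrightarrow> y \<in> V \<Longrightarrow>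
    of_real (M x y) = (\<Sum>\<xi>\<in>X. of_real (\<phi> \<xi>) * (\<psi> \<xi> x * cnj (\<psi> \<xi> y))) / of_nat (card V)"
  shows "card V * (\<Sum>x\<in>V. \<Sum>y\<in>V. f x * M x y * f y) = (\<Sum>\<xi>\<in>X. \<phi> \<xi> * (cmod (transform f \<xi>))\<^sup>2)"
proof -
  have "of_real (card V * (\<Sum>x\<in>V. \<Sum>y\<in>V. f x * M x y * f y))
      = of_nat (card V) * (\<Sum>x\<in>V. \<Sum>y\<in>V. of_real (f x) * of_real (M x y) * (of_real (f y) :: complex))"
    by simp
  also have "\<dots> = (\<Sum>x\<in>V. \<Sum>y\<in>V. \<Sum>\<xi>\<in>X. of_real (\<phi> \<xi>) * (of_real (f x) * \<psi> \<xi> x * (of_real (f y) * cnj (\<psi> \<xi> y))))"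
    unfolding sum_distrib_left
  proof (intro sum.cong refl)
    fix x y assume "x \<in> V" "y \<in> V"
    then show "of_nat (card V) * (of_real (f x) * of_real (M x y) * of_real (f y)) =
        (\<Sum>\<xi>\<in>X. of_real (\<phi> \<xi>) * (of_real (f x) * \<psi> \<xi> x * (of_real (f y) * cnj (\<psi> \<xi> y))))"
      using card_V_pos by (simp add: assms sum_distrib_left sum_distrib_right sum_divide_distrib mult_ac)
  qed
  also have "\<dots> = (\<Sum>x\<in>V. \<Sum>\<xi>\<in>X. \<Sum>y\<in>V. of_real (\<phi> \<xi>) * (of_real (f x) * \<psi> \<xi> x * (of_real (f y) * cnj (\<psi> \<xi> y))))"
    by (intro sum.cong refl sum.swap)
  also have "\<dots> = (\<Sum>\<xi>\<in>X. \<Sum>x\<in>V. \<Sum>y\<in>V. of_real (\<phi> \<xi>) * (of_real (f x) * \<psi> \<xi> x * (of_real (f y) * cnj (\<psi> \<xi> y))))"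
    by (rule sum.swap)
  also have "\<dots> = (\<Sum>\<xi>\<in>X. of_real (\<phi> \<xi>) * (transform f \<xi> * cnj (transform f \<xi>)))"
    by (simp only: transform_def cnj_sum sum_product complex_cnj_mult complex_cnj_complex_of_real)
       (simp only: sum_distrib_left)
  also have "\<dots> = of_real (\<Sum>\<xi>\<in>X. \<phi> \<xi> * (cmod (transform f \<xi>))\<^sup>2)"
    by (simp add: complex_norm_square[symmetric])
  finally show ?thesis by (simp only: of_real_eq_iff)
qed

lemma parseval:
  fixes f :: "'v \<Rightarrow> real"
  shows "card V * (\<Sum>x\<in>V. (f x)\<^sup>2) = (\<Sum>\<xi>\<in>X. (cmod (transform f \<xi>))\<^sup>2)"
proof -
  have "(\<Sum>x\<in>V. \<Sum>y\<in>V. f x * (if x = y then 1 else 0) * f y) = (\<Sum>x\<in>V. (f x)\<^sup>2)"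
    using finite_V by (simp add: if_distrib[of "\<lambda>u. _ * u * _"] power2_eq_square cong: if_cong)
  moreover have "of_real (if x = y then 1 else 0)
      = (\<Sum>\<xi>\<in>X. of_real 1 * (\<psi> \<xi> x * cnj (\<psi> \<xi> y))) / of_nat (card V)" if "x \<in> V" "y \<in> V" for x y
    using completeness[OF that] card_V_pos by simp
  ultimately show ?thesis
    using quadratic_form_spectral[of "\<lambda>x y. if x = y then 1 else 0" "\<lambda>_. 1" f] by simp
qed

lemma energy_spectral:
  fixes f :: "'v \<Rightarrow> real"
  shows "card V * (\<Sum>x\<in>V. (f x - (\<Sum>y\<in>V. K x y * f y)) * f x)
    = (\<Sum>\<xi>\<in>X. (1 - \<kappa> \<xi>) * (cmod (transform f \<xi>))\<^sup>2)"
proof -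
  have "(\<Sum>x\<in>V. (f x - (\<Sum>y\<in>V. K x y * f y)) * f x)
      = (\<Sum>x\<in>V. (f x)\<^sup>2) - (\<Sum>x\<in>V. \<Sum>y\<in>V. f x * K x y * f y)"
    by (simp add: left_diff_distrib right_diff_distrib power2_eq_square sum_subtractf sum_distrib_left mult_ac)
  then have "card V * (\<Sum>x\<in>V. (f x - (\<Sum>y\<in>V. K x y * f y)) * f x)
      = card V * (\<Sum>x\<in>V. (f x)\<^sup>2) - card V * (\<Sum>x\<in>V. \<Sum>y\<in>V. f x * K x y * f y)"
    by (simp only: right_diff_distrib)
  also have "\<dots> = (\<Sum>\<xi>\<in>X. (cmod (transform f \<xi>))\<^sup>2) - (\<Sum>\<xi>\<in>X. \<kappa> \<xi> * (cmod (transform f \<xi>))\<^sup>2)"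
    by (simp only: parseval quadratic_form_spectral[OF kernel_spectral])
  finally show ?thesis by (simp add: left_diff_distrib sum_subtractf)
qed

lemma cmod_transform_le: "\<xi> \<in> X \<Longrightarrow> cmod (transform f \<xi>) \<le> (\<Sum>x\<in>V. \<bar>f x\<bar>)"
  unfolding transform_def
  by (rule order_trans[OF norm_sum]) (simp add: norm_mult norm_psi)

lemma transform_trivial: "transform f \<xi>\<^sub>0 = of_real (\<Sum>x\<in>V. f x)"
  by (simp add: transform_def trivial_psi)

text \<open>Apply \<open>1 \<le> exp (- u) + u\<close> with \<open>u = t (1 - \<kappa> \<xi>)\<close> to every frequency in Parseval's identity. In the
  exponential part the transform is bounded by the \<open>1\<close>-norm of \<open>f\<close>, which leaves the heat trace; the
  linear part is the energy.\<close>

lemma nash_inequality: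
  fixes f :: "'v \<Rightarrow> real"
  assumes "t \<ge> 0" "\<And>\<xi>. \<xi> \<in> X \<Longrightarrow> \<kappa> \<xi> \<le> 1"
  shows "card V * (\<Sum>x\<in>V. (f x)\<^sup>2) \<le> (\<Sum>\<xi>\<in>X. exp (- t * (1 - \<kappa> \<xi>))) * (\<Sum>x\<in>V. \<bar>f x\<bar>)\<^sup>2
    + t * (card V * (\<Sum>x\<in>V. (f x - (\<Sum>y\<in>V. K x y * f y)) * f x))"
proof -
  have "card V * (\<Sum>x\<in>V. (f x)\<^sup>2) = (\<Sum>\<xi>\<in>X. 1 * (cmod (transform f \<xi>))\<^sup>2)"
    by (simp add: parseval)
  also have "\<dots> \<le> (\<Sum>\<xi>\<in>X. (exp (- t * (1 - \<kappa> \<xi>)) + t * (1 - \<kappa> \<xi>)) * (cmod (transform f \<xi>))\<^sup>2)"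
  proof (intro sum_mono mult_right_mono)
    fix \<xi> assume "\<xi> \<in> X"
    show "1 \<le> exp (- t * (1 - \<kappa> \<xi>)) + t * (1 - \<kappa> \<xi>)"
      using exp_ge_add_one_self[of "- t * (1 - \<kappa> \<xi>)"] by simp
  qed simp
  also have "\<dots> = (\<Sum>\<xi>\<in>X. exp (- t * (1 - \<kappa> \<xi>)) * (cmod (transform f \<xi>))\<^sup>2)
      + t * (\<Sum>\<xi>\<in>X. (1 - \<kappa> \<xi>) * (cmod (transform f \<xi>))\<^sup>2)"
    by (simp only: distrib_right sum.distrib sum_distrib_left mult.assoc)
  also have "(\<Sum>\<xi>\<in>X. exp (- t * (1 - \<kappa> \<xi>)) * (cmod (transform f \<xi>))\<^sup>2)
      \<le> (\<Sum>\<xi>\<in>X. exp (- t * (1 - \<kappa> \<xi>)) * (\<Sum>x\<in>V. \<bar>f x\<bar>)\<^sup>2)"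
    by (intro sum_mono mult_left_mono power_mono cmod_transform_le) auto
  finally show ?thesis by (simp add: energy_spectral sum_distrib_right)
qed

lemma energy_nonneg:
  fixes f :: "'v \<Rightarrow> real"
  assumes "\<And>\<xi>. \<xi> \<in> X \<Longrightarrow> \<kappa> \<xi> \<le> 1"
  shows "(\<Sum>x\<in>V. (f x - (\<Sum>y\<in>V. K x y * f y)) * f x) \<ge> 0"
proof -
  have "card V * (\<Sum>x\<in>V. (f x - (\<Sum>y\<in>V. K x y * f y)) * f x) \<ge> 0"
    unfolding energy_spectral using assms by (intro sum_nonneg) auto
  then show ?thesis using card_V_pos by (simp add: zero_le_mult_iff)
qed

text \<open>The variance is the spectral mass of \<open>f\<close> away from the trivial frequency, where \<open>1 - \<kappa> \<xi> \<ge> \<gamma>\<close>.\<close>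

lemma poincare_inequality:
  assumes "\<And>\<xi>. \<xi> \<in> X - {\<xi>\<^sub>0} \<Longrightarrow> \<gamma> \<le> 1 - \<kappa> \<xi>"
  shows "\<gamma> * measure_pmf.variance (pmf_of_set V) f \<le> dirichlet_form V K (pmf_of_set V) f f"
proof -
  have "card V * (\<Sum>x\<in>V. (f x)\<^sup>2) - (\<Sum>x\<in>V. f x)\<^sup>2 = (\<Sum>\<xi>\<in>X - {\<xi>\<^sub>0}. (cmod (transform f \<xi>))\<^sup>2)"
    unfolding parseval using finite_X trivial_in
    by (subst sum.remove[of X \<xi>\<^sub>0]) (auto simp: transform_trivial simp del: of_real_sum)
  then have "\<gamma> * (card V * (\<Sum>x\<in>V. (f x)\<^sup>2) - (\<Sum>x\<in>V. f x)\<^sup>2)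
      = (\<Sum>\<xi>\<in>X - {\<xi>\<^sub>0}. \<gamma> * (cmod (transform f \<xi>))\<^sup>2)"
    by (simp add: sum_distrib_left)
  also have "\<dots> \<le> (\<Sum>\<xi>\<in>X - {\<xi>\<^sub>0}. (1 - \<kappa> \<xi>) * (cmod (transform f \<xi>))\<^sup>2)"
    by (intro sum_mono mult_right_mono assms) auto
  also have "\<dots> = card V * (\<Sum>x\<in>V. (f x - (\<Sum>y\<in>V. K x y * f y)) * f x)"
    unfolding energy_spectral using finite_X trivial_in by (simp add: sum.remove[of X \<xi>\<^sub>0] trivial_kappa)
  finally have "\<gamma> * (card V * (\<Sum>x\<in>V. (f x)\<^sup>2) - (\<Sum>x\<in>V. f x)\<^sup>2) / (card V)\<^sup>2
      \<le> card V * (\<Sum>x\<in>V. (f x - (\<Sum>y\<in>V. K x y * f y)) * f x) / (card V)\<^sup>2"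
    by (intro divide_right_mono) auto
  then show ?thesis
    unfolding variance_uniform[OF finite_V V_nonempty] dirichlet_form_uniform[OF finite_V V_nonempty]
    using card_V_pos by (simp add: power2_eq_square field_simps)
qed

end

section \<open>The heat trace of a cycle\<close>

lemma one_minus_cos_eq: "1 - cos (2 * x) = 2 * (sin x)\<^sup>2" for x :: real
  by (simp add: cos_double_sin)

text \<open>A crude form of Jordan's inequality, from \<open>\<bar>sin x - x\<bar> \<le> x\<^sup>3/6\<close> and \<open>x\<^sup>2 \<le> 3\<close> on the interval.\<close>

lemma sin_ge_half:
  fixes x :: real
  assumes "0 \<le> x" "x \<le> pi / 2"
  shows "x / 2 \<le> sin x"
proof -
  have "\<bar>sin x - (\<Sum>m<3. sin_coeff m * x ^ m)\<bar> \<le> inverse (fact 3) * \<bar>x\<bar> ^ 3"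
    by (rule Maclaurin_sin_bound)
  moreover have "(\<Sum>m<3. sin_coeff m * x ^ m) = x"
    by (simp add: numeral_eq_Suc sin_coeff_def)
  moreover have "x ^ 3 \<le> 3 * x"
  proof -
    have "x \<le> 1.6" using assms pi_less_4 pi_approx by simp
    then have "x\<^sup>2 \<le> 1.6\<^sup>2" using assms by (intro power_mono) auto
    then have "x\<^sup>2 \<le> 3" by (simp add: power2_eq_square)
    then show ?thesis using mult_right_mono[of "x\<^sup>2" 3 x] assms by (simp add: power3_eq_cube power2_eq_square)
  qed
  ultimately have "\<bar>sin x - x\<bar> \<le> x / 2"
    using assms by (simp add: fact_numeral)
  then show ?thesis by linarith
qed

lemma one_minus_cos_le: "1 - cos (2 * pi * x) \<le> 20 * x\<^sup>2" for x :: real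
proof -
  have "(sin (pi * x))\<^sup>2 \<le> (pi * x)\<^sup>2"
    using abs_sin_x_le_abs_x[of "pi * x"] by (simp add: abs_le_square_iff)
  moreover have "pi\<^sup>2 \<le> 10"
  proof -
    have "pi\<^sup>2 \<le> 3.15\<^sup>2" using pi_approx by (intro power_mono) auto
    then show ?thesis by (simp add: power2_eq_square)
  qed
  then have "pi\<^sup>2 * x\<^sup>2 \<le> 10 * x\<^sup>2" by (intro mult_right_mono) auto
  ultimately show ?thesis
    using one_minus_cos_eq[of "pi * x"] by (simp add: power_mult_distrib mult.assoc)
qed

lemma one_minus_cos_ge:
  fixes x :: real
  assumes "0 \<le> x" "x \<le> 1 / 2"
  shows "4 * x\<^sup>2 \<le> 1 - cos (2 * pi * x)"
proof -
  have "pi * x / 2 \<le> sin (pi * x)"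
    using assms mult_left_mono[of x "1/2" pi] by (intro sin_ge_half) auto
  moreover have "3 * x \<le> pi * x" using assms pi_gt3 by (intro mult_right_mono) auto
  ultimately have "(3 / 2 * x)\<^sup>2 \<le> (sin (pi * x))\<^sup>2"
    using assms by (intro power_mono) auto
  moreover have "(3 / 2 * x)\<^sup>2 = 9 / 4 * x\<^sup>2" by (simp add: power_mult_distrib power2_eq_square)
  moreover have "1 - cos (2 * pi * x) = 2 * (sin (pi * x))\<^sup>2"
    using one_minus_cos_eq[of "pi * x"] by (simp add: mult.assoc)
  ultimately show ?thesis using zero_le_power2[of x] by linarith
qed

lemma cos_reflect_frequency:
  assumes "n \<ge> 1" "k \<le> n"
  shows "cos (2 * pi * (real (n - k) / real n)) = cos (2 * pi * (real k / real n))"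
proof -
  have "2 * pi * (real (n - k) / real n) = 2 * pi - 2 * pi * (real k / real n)"
    using assms by (simp add: of_nat_diff field_simps)
  then show ?thesis by (simp add: cos_diff)
qed

text \<open>Replacing \<open>k\<close> by \<open>n - k\<close> brings the frequency into the range of \<open>one_minus_cos_ge\<close>, where the
  bound increases with the frequency.\<close>

lemma cycle_gap_ge:
  assumes "k \<in> {1..<n}"
  shows "4 * (1 / real n)\<^sup>2 \<le> 1 - cos (2 * pi * (real k / real n))"
proof -
  define m where "m = (if 2 * k \<le> n then k else n - k)"
  have m: "m \<ge> 1" "2 * m \<le> n" using assms by (auto simp: m_def)
  have c: "cos (2 * pi * (real m / real n)) = cos (2 * pi * (real k / real n))"
    using cos_reflect_frequency[of n k] assms by (simp only: m_def split: if_split) auto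
  have "(1 / real n)\<^sup>2 \<le> (real m / real n)\<^sup>2" using m by (intro power_mono divide_right_mono) auto
  also have "4 * (real m / real n)\<^sup>2 \<le> 1 - cos (2 * pi * (real m / real n))"
    using m assms by (intro one_minus_cos_ge) (auto simp: field_simps)
  finally show ?thesis by (simp only: c)
qed

text \<open>Up to the factor \<open>n\<close>, this is the return probability \<open>H\<^sub>s(x, x)\<close> of the walk with steps \<open>\<plusminus>1\<close> on the
  cycle of length \<open>n\<close>.\<close>

definition cycle_trace :: "nat \<Rightarrow> real \<Rightarrow> real" where
  "cycle_trace n s = (\<Sum>k<n. exp (- s * (1 - cos (2 * pi * (real k / real n)))))"

lemma cycle_trace_nontrivial:
  assumes "n \<ge> 1"
  shows "cycle_trace n s = 1 + (\<Sum>k\<in>{1..<n}. exp (- s * (1 - cos (2 * pi * (real k / real n)))))"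
proof -
  have "{..<n} = insert 0 {1..<n}" using assms by auto
  then show ?thesis by (simp add: cycle_trace_def)
qed

lemma cycle_trace_ge_1: "n \<ge> 1 \<Longrightarrow> cycle_trace n s \<ge> 1"
  by (simp add: cycle_trace_nontrivial sum_nonneg)

lemma cycle_trace_antimono: "s \<le> s' \<Longrightarrow> cycle_trace n s' \<le> cycle_trace n s"
  unfolding cycle_trace_def by (intro sum_mono) (auto intro!: mult_right_mono)

text \<open>Each frequency \<open>k\<close> is within \<open>n/2\<close> of \<open>0\<close> or of \<open>n\<close>. Bounding its term by the sum of both
  Gaussians avoids a case distinction in the sum, and the reflection \<open>k \<mapsto> n - k\<close> identifies the two
  resulting sums.\<close>

lemma cycle_trace_le_gaussian:
  assumes "n \<ge> 1" "s \<ge> 0"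
  shows "cycle_trace n s \<le> 1 + 2 * (\<Sum>k\<in>{1..<n}. exp (- 4 * s * (real k / real n)\<^sup>2))"
proof -
  let ?g = "\<lambda>k. exp (- 4 * s * (real k / real n)\<^sup>2)"
  have "exp (- s * (1 - cos (2 * pi * (real k / real n)))) \<le> ?g k + ?g (n - k)" if k: "k \<in> {1..<n}" for k
  proof (cases "2 * k \<le> n")
    case True
    then have "4 * (real k / real n)\<^sup>2 \<le> 1 - cos (2 * pi * (real k / real n))"
      using k by (intro one_minus_cos_ge) (auto simp: field_simps)
    then have "exp (- s * (1 - cos (2 * pi * (real k / real n)))) \<le> ?g k"
      using mult_left_mono[OF _ assms(2)] by fastforce
    then show ?thesis using exp_ge_zero[of "- 4 * s * (real (n - k) / real n)\<^sup>2"] by linarith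
  next
    case False
    have c: "cos (2 * pi * (real (n - k) / real n)) = cos (2 * pi * (real k / real n))"
      using k by (intro cos_reflect_frequency) auto
    have "4 * (real (n - k) / real n)\<^sup>2 \<le> 1 - cos (2 * pi * (real (n - k) / real n))"
      using k False by (intro one_minus_cos_ge) (auto simp: field_simps)
    then have "exp (- s * (1 - cos (2 * pi * (real k / real n)))) \<le> ?g (n - k)"
      unfolding c using mult_left_mono[OF _ assms(2)] by fastforce
    then show ?thesis using exp_ge_zero[of "- 4 * s * (real k / real n)\<^sup>2"] by linarith
  qed
  then have "(\<Sum>k\<in>{1..<n}. exp (- s * (1 - cos (2 * pi * (real k / real n)))))
      \<le> (\<Sum>k\<in>{1..<n}. ?g k + ?g (n - k))"
    by (intro sum_mono)
  also have "\<dots> = 2 * (\<Sum>k\<in>{1..<n}. ?g k)"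
  proof -
    have "(\<Sum>k\<in>{1..<n}. ?g (n - k)) = (\<Sum>k\<in>{1..<n}. ?g k)"
      by (rule sum.reindex_bij_witness[of _ "\<lambda>k. n - k" "\<lambda>k. n - k"]) auto
    then show ?thesis by (simp add: sum.distrib)
  qed
  finally show ?thesis using cycle_trace_nontrivial[OF assms(1)] by simp
qed

lemma sum_exp_le:
  fixes \<beta> :: real
  assumes "\<beta> > 0"
  shows "(\<Sum>k\<in>{1..<n}. exp (- \<beta> * real k)) \<le> 1 / \<beta>"
proof -
  have "(\<Sum>k\<in>{1..<n}. exp (- \<beta> * real k)) \<le> (\<Sum>k\<in>{1..<Suc n}. exp (- \<beta> * real k))"
    by (intro sum_mono2) auto
  also have "\<dots> = exp (- \<beta>) * (\<Sum>k<n. exp (- \<beta>) ^ k)"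
    unfolding sum_distrib_left
    by (rule sum.reindex_bij_witness[of _ Suc "\<lambda>k. k - 1"])
       (auto simp: exp_of_nat_mult[symmetric] exp_add[symmetric] algebra_simps)
  also have "\<dots> = exp (- \<beta>) * ((1 - exp (- \<beta>) ^ n) / (1 - exp (- \<beta>)))"
    using assms by (subst sum_gp_strict) auto
  also have "\<dots> \<le> exp (- \<beta>) * (1 / (1 - exp (- \<beta>)))"
    using assms by (intro mult_left_mono divide_right_mono) auto
  also have "\<dots> = 1 / (exp \<beta> - 1)"
    using assms by (simp add: exp_minus field_simps)
  also have "\<dots> \<le> 1 / \<beta>"
  proof -
    have "\<beta> \<le> exp \<beta> - 1" using exp_ge_add_one_self[of \<beta>] by linarith
    then show ?thesis using assms by (intro divide_left_mono) auto
  qed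
  finally show ?thesis .
qed

text \<open>The Gaussian sum is reduced to a geometric one by \<open>(u k)\<^sup>2 \<ge> 2 u k - 1\<close>, which loses only the
  constant factor \<open>exp 1\<close>. For \<open>s < 1\<close> the trivial bound \<open>F\<^sub>n(s) \<le> n\<close> is enough.\<close>

lemma cycle_trace_upper:
  assumes "n \<ge> 1" "s \<ge> 0"
  shows "cycle_trace n s \<le> 1 + 4 * real n / sqrt (s + 1)"
proof (cases "s \<ge> 1")
  case True
  define u where "u = 2 * sqrt s / real n"
  have u: "u > 0" using True assms by (simp add: u_def)
  have "(\<Sum>k\<in>{1..<n}. exp (- 4 * s * (real k / real n)\<^sup>2)) \<le> (\<Sum>k\<in>{1..<n}. exp 1 * exp (- (2 * u) * real k))"
  proof (intro sum_mono)
    fix k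
    have "4 * s * (real k / real n)\<^sup>2 = (u * real k)\<^sup>2"
      using assms by (simp add: u_def power_mult_distrib power_divide)
    moreover have "0 \<le> (u * real k - 1)\<^sup>2" by simp
    ultimately have "- 4 * s * (real k / real n)\<^sup>2 \<le> 1 + - (2 * u) * real k"
      by (simp add: power2_eq_square algebra_simps)
    then show "exp (- 4 * s * (real k / real n)\<^sup>2) \<le> exp 1 * exp (- (2 * u) * real k)"
      unfolding exp_add[symmetric] by simp
  qed
  also have "\<dots> \<le> exp 1 * (1 / (2 * u))"
    unfolding sum_distrib_left[symmetric] using u by (intro mult_left_mono sum_exp_le) auto
  also have "\<dots> \<le> 3 * (1 / (2 * u))"
    using u exp_le by (intro mult_right_mono) auto
  also have "\<dots> = 3 * real n / (4 * sqrt s)" by (simp add: u_def)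
  finally have "cycle_trace n s \<le> 1 + 2 * (3 * real n / (4 * sqrt s))"
    using cycle_trace_le_gaussian[OF assms] by linarith
  also have "2 * (3 * real n / (4 * sqrt s)) \<le> 4 * real n / sqrt (s + 1)"
  proof -
    have "sqrt (s + 1) \<le> sqrt (4 * s)" using True by simp
    then have "sqrt (s + 1) \<le> 2 * sqrt s" by (simp add: real_sqrt_mult)
    then have "3 * sqrt (s + 1) \<le> 8 * sqrt s" using True real_sqrt_ge_zero[of s] by linarith
    then have "real n * (3 * sqrt (s + 1)) \<le> real n * (8 * sqrt s)" by (intro mult_left_mono) auto
    then show ?thesis using True by (simp add: field_simps)
  qed
  finally show ?thesis by simp
next
  case False
  have "cycle_trace n s \<le> (\<Sum>k<n. 1)"
    unfolding cycle_trace_def using assms by (intro sum_mono) (auto simp: mult_le_0_iff)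
  also have "\<dots> \<le> 4 * real n / sqrt (s + 1)"
  proof -
    have "sqrt (s + 1) \<le> sqrt 4" using False by (intro real_sqrt_le_mono) simp
    then have "sqrt (s + 1) \<le> 4" by simp
    then have "real n * sqrt (s + 1) \<le> real n * 4" by (intro mult_left_mono) auto
    then show ?thesis using assms by (simp add: field_simps)
  qed
  finally show ?thesis by simp
qed

text \<open>With \<open>\<alpha> = s/n\<^sup>2 \<ge> 1/3\<close>, a quarter of the exponent \<open>4 \<alpha> k\<^sup>2\<close> supplies the decay \<open>exp (- \<alpha>)\<close>, and the
  remaining part dominates \<open>k\<close> and makes the sum converge. The threshold \<open>n\<^sup>2/3\<close> matches the least
  weight \<open>1/3\<close> of a side of the torus.\<close>

lemma cycle_trace_upper_exp:
  assumes "n \<ge> 1" "s \<ge> (real n)\<^sup>2 / 3"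
  shows "cycle_trace n s - 1 \<le> 6 * exp (- s / (real n)\<^sup>2)"
proof -
  define \<alpha> where "\<alpha> = s / (real n)\<^sup>2"
  have \<alpha>: "\<alpha> \<ge> 1 / 3" using assms by (simp add: \<alpha>_def field_simps)
  have s0: "s \<ge> 0" using assms(2) by (smt (verit) zero_le_power2 divide_nonneg_nonneg)
  have "(\<Sum>k\<in>{1..<n}. exp (- 4 * s * (real k / real n)\<^sup>2)) \<le> (\<Sum>k\<in>{1..<n}. exp (- \<alpha>) * exp (- 1 * real k))"
  proof (intro sum_mono)
    fix k assume k: "k \<in> {1..<n}"
    have "real k * 1 \<le> real k * real k" using k by (intro mult_left_mono) auto
    then have "\<alpha> * real k \<le> \<alpha> * (real k)\<^sup>2" using \<alpha> by (intro mult_left_mono) (auto simp: power2_eq_square)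
    moreover have "1 * real k \<le> 3 * \<alpha> * real k" using \<alpha> by (intro mult_right_mono) auto
    moreover have "\<alpha> * 1 \<le> \<alpha> * real k" using \<alpha> k by (intro mult_left_mono) auto
    ultimately have "\<alpha> + real k \<le> 4 * (\<alpha> * (real k)\<^sup>2)" by simp
    then have "- 4 * s * (real k / real n)\<^sup>2 \<le> - \<alpha> + - 1 * real k"
      using assms(1) by (simp add: \<alpha>_def power_divide)
    then show "exp (- 4 * s * (real k / real n)\<^sup>2) \<le> exp (- \<alpha>) * exp (- 1 * real k)"
      unfolding exp_add[symmetric] by simp
  qed
  also have "\<dots> \<le> exp (- \<alpha>) * (1 / 1)"
    unfolding sum_distrib_left[symmetric] by (intro mult_left_mono sum_exp_le) auto
  finally have "cycle_trace n s - 1 \<le> 6 * exp (- \<alpha>)"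
    using cycle_trace_le_gaussian[OF assms(1) s0] exp_gt_zero[of "- \<alpha>"] by linarith
  then show ?thesis by (simp add: \<alpha>_def)
qed

lemma cycle_trace_lower_exp:
  assumes "n \<ge> 2" "s \<ge> 0"
  shows "exp (- 20 * s / (real n)\<^sup>2) \<le> cycle_trace n s - 1"
proof -
  have "s * (1 - cos (2 * pi * (real 1 / real n))) \<le> s * (20 * (real 1 / real n)\<^sup>2)"
    using assms by (intro mult_left_mono one_minus_cos_le) auto
  then have "exp (- 20 * s / (real n)\<^sup>2) \<le> exp (- s * (1 - cos (2 * pi * (real 1 / real n))))"
    by (simp add: power_divide mult.commute)
  also have "\<dots> \<le> (\<Sum>k\<in>{1..<n}. exp (- s * (1 - cos (2 * pi * (real k / real n)))))"
    using assms by (intro member_le_sum) auto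
  finally show ?thesis using cycle_trace_nontrivial[of n s] assms by simp
qed

text \<open>Up to time \<open>n\<^sup>2\<close> the walk has not mixed on a cycle of length \<open>n\<close>, so the main term
  \<open>n/\<surd>(t + 1)\<close> of the trace is not small compared with the constant \<open>1\<close>.\<close>

lemma half_le_side_over_sqrt:
  fixes t :: real
  assumes "n \<ge> 1" "0 \<le> t" "t \<le> (real n)\<^sup>2"
  shows "1 / 2 \<le> real n / sqrt (t + 1)"
proof -
  have "1\<^sup>2 \<le> (real n)\<^sup>2" using assms by (intro power_mono) auto
  then have "1 \<le> (real n)\<^sup>2" by simp
  with assms(3) have "t + 1 \<le> 4 * (real n)\<^sup>2" by linarith
  then have "sqrt (t + 1) \<le> 2 * real n"
    using assms by (intro real_le_lsqrt) (auto simp: power_mult_distrib)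
  then show ?thesis using assms by (simp add: field_simps)
qed

text \<open>The frequencies \<open>1 \<le> k \<le> m\<close> with \<open>m\<close> about \<open>n / (2 \<surd>(s + 1))\<close> each contribute at least a
  constant, because \<open>s k\<^sup>2/n\<^sup>2\<close> stays bounded for them.\<close>

lemma cycle_trace_lower:
  assumes "n \<ge> 2" "s \<ge> 0" "s \<le> (real n)\<^sup>2"
  shows "exp (- 180) / 2 * (real n / sqrt (s + 1)) \<le> cycle_trace n s - 1"
proof -
  define x where "x = real n / sqrt (s + 1)"
  \<comment> \<open>Rounding up keeps the frequency \<open>k = 1\<close> even when \<open>x\<close> is close to \<open>1/2\<close>; halving keeps
    \<open>m\<close> below \<open>n\<close>, also for \<open>n = 2\<close> and \<open>s = 0\<close>.\<close>
  define m where "m = nat \<lceil>x / 2\<rceil>"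
  have s1: "sqrt (s + 1) > 0" using assms by simp
  have x0: "x > 0" using assms by (simp add: x_def)
  have "sqrt (s + 1) \<ge> 1" using assms by simp
  then have xn: "x \<le> real n" using assms s1 by (simp add: x_def field_simps)
  have x12: "1 / 2 \<le> x" unfolding x_def using assms by (intro half_le_side_over_sqrt) auto
  have mx: "x / 2 \<le> real m" "real m < x / 2 + 1" using x0 unfolding m_def by linarith+
  have mn: "m < n" using mx xn assms by linarith
  have "exp (- 180) / 2 * x \<le> real m * exp (- 180)" using mx by simp
  also have "\<dots> = (\<Sum>k\<in>{1..<Suc m}. exp (- 180))" by simp
  also have "\<dots> \<le> (\<Sum>k\<in>{1..<Suc m}. exp (- s * (1 - cos (2 * pi * (real k / real n)))))"
  proof (intro sum_mono)
    fix k assume k: "k \<in> {1..<Suc m}"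
    have "real k \<le> 3 * x" using k mx x12 by auto
    then have "real k / real n \<le> 3 * x / real n" by (intro divide_right_mono) auto
    also have "\<dots> = 3 / sqrt (s + 1)" using assms by (simp add: x_def)
    finally have "(real k / real n)\<^sup>2 \<le> (3 / sqrt (s + 1))\<^sup>2" by (intro power_mono) auto
    also have "\<dots> = 9 / (s + 1)" using assms by (simp add: power_divide)
    finally have "20 * (real k / real n)\<^sup>2 \<le> 180 / (s + 1)" by simp
    then have "1 - cos (2 * pi * (real k / real n)) \<le> 180 / (s + 1)"
      using one_minus_cos_le[of "real k / real n"] by simp
    then have "s * (1 - cos (2 * pi * (real k / real n))) \<le> s * (180 / (s + 1))"
      using assms by (intro mult_left_mono) auto
    also have "\<dots> \<le> 180" using assms by (simp add: field_simps)
    finally show "exp (- 180) \<le> exp (- s * (1 - cos (2 * pi * (real k / real n))))" by simp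
  qed
  also have "\<dots> \<le> (\<Sum>k\<in>{1..<n}. exp (- s * (1 - cos (2 * pi * (real k / real n)))))"
    using mn by (intro sum_mono2) auto
  finally show ?thesis using cycle_trace_nontrivial[of n s] assms by (simp add: x_def)
qed

section \<open>Diagonalisation of the walk on the torus\<close>

lemma carrier_torus:
  assumes "a \<ge> 2" "b \<ge> 2"
  shows "carrier (torus a b) = {0..<int a} \<times> {0..<int b}"
  using assms by (simp add: torus_def carrier_integer_mod_group)

lemma card_torus:
  assumes "a \<ge> 2" "b \<ge> 2"
  shows "card (carrier (torus a b)) = a * b"
  using assms by (simp add: carrier_torus)

lemma torus_finite_nonempty:
  assumes "a \<ge> 2" "b \<ge> 2"
  shows "finite (carrier (torus a b))" "carrier (torus a b) \<noteq> {}"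
  using assms by (auto simp: carrier_torus)

lemma mult_torus: "(x1, x2) \<otimes>\<^bsub>torus a b\<^esub> (y1, y2) = ((x1 + y1) mod int a, (x2 + y2) mod int b)"
  by (simp add: torus_def)

text \<open>The number of distinct steps in \<open>{1, -1}\<close> modulo \<open>n\<close>.\<close>

definition cycle_degree :: "nat \<Rightarrow> real" where
  "cycle_degree n = (if n = 2 then 1 else 2)"

text \<open>The probability that a step of the walk on the torus goes along the side of length \<open>a\<close>; by
  symmetry \<open>axis_weight b a\<close> belongs to the other side.\<close>

definition axis_weight :: "nat \<Rightarrow> nat \<Rightarrow> real" where
  "axis_weight a b = cycle_degree a / (cycle_degree a + cycle_degree b)"

lemma axis_weight_ge: "axis_weight a b \<ge> 1 / 3"
  by (simp add: axis_weight_def cycle_degree_def)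

lemma axis_weight_sum: "axis_weight a b + axis_weight b a = 1"
  by (simp add: axis_weight_def cycle_degree_def)

text \<open>For \<open>n = 2\<close> the two steps coincide and are counted once. Since both summands are then equal, the sum
  over the set of steps is still proportional to the sum over the signs, with the number of distinct
  steps as the only trace of the degeneracy.\<close>

lemma cycle_steps:
  assumes "n \<ge> 2"
  shows "card {1 mod int n, (-1) mod int n} = cycle_degree n"
    and "(\<Sum>s\<in>{1 mod int n, (-1) mod int n}. h s)
      = (cycle_degree n / 2) *\<^sub>R (h (1 mod int n) + h ((-1) mod int n :: int) :: 'c :: real_vector)"
proof -
  have m: "1 mod int n = 1" "(-1) mod int n = int n - 1"
    using assms by (simp_all add: zmod_minus1)
  show "card {1 mod int n, (-1) mod int n} = cycle_degree n"
    unfolding m by (cases "n = 2") (auto simp: cycle_degree_def card_insert_if)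
  show "(\<Sum>s\<in>{1 mod int n, (-1) mod int n}. h s)
      = (cycle_degree n / 2) *\<^sub>R (h (1 mod int n) + h ((-1) mod int n))"
  proof (cases "n = 2")
    case True
    then show ?thesis by (simp add: cycle_degree_def scaleR_2[symmetric])
  next
    case False
    then have "1 \<noteq> int n - 1" by simp
    then show ?thesis using False unfolding m by (simp add: cycle_degree_def)
  qed
qed

text \<open>One step of the walk as a weighted average of the simple walks on the two cycles, for every pair of
  side lengths. The value space is a real vector space so that the rule serves the characters as well
  as real test functions.\<close>

lemma sum_torus_kernel:
  fixes f :: "int \<times> int \<Rightarrow> 'c :: real_vector"
  assumes "a \<ge> 2" "b \<ge> 2" and x: "x1 \<in> {0..<int a}" "x2 \<in> {0..<int b}"
  shows "(\<Sum>y\<in>carrier (torus a b). torus_kernel a b (x1, x2) y *\<^sub>R f y)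
    = (axis_weight a b / 2) *\<^sub>R (f ((x1 + 1) mod int a, x2) + f ((x1 - 1) mod int a, x2))
      + (axis_weight b a / 2) *\<^sub>R (f (x1, (x2 + 1) mod int b) + f (x1, (x2 - 1) mod int b))"
proof -
  let ?V = "carrier (torus a b)"
  let ?A = "{1 mod int a, (-1) mod int a}" and ?B = "{1 mod int b, (-1) mod int b}"
  let ?T = "\<lambda>(s1, s2). ((x1 + s1) mod int a, (x2 + s2) mod int b)"
  have gens: "torus_gens a b = (?A \<times> {0}) \<union> ({0} \<times> ?B)"
    by (auto simp: torus_gens_def)
  have nz: "0 \<notin> ?A" "0 \<notin> ?B" using assms by (auto simp: zmod_minus1)
  have disj: "(?A \<times> {0}) \<inter> ({0} \<times> ?B) = {}" using nz by auto
  have fin: "finite (torus_gens a b)" by (simp add: torus_gens_def)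
  have gV: "torus_gens a b \<subseteq> {0..<int a} \<times> {0..<int b}"
    unfolding torus_gens_def using assms by auto
  let ?c = "real (card (torus_gens a b))"
  have c: "?c = cycle_degree a + cycle_degree b"
    unfolding gens using cycle_steps(1)[OF assms(1)] cycle_steps(1)[OF assms(2)]
    by (subst card_Un_disjoint[OF _ _ disj]) (simp_all only: card_cartesian_product, auto)
  have inj: "inj_on ?T (torus_gens a b)"
  proof (rule inj_onI)
    fix s s' assume s: "s \<in> torus_gens a b" "s' \<in> torus_gens a b" "?T s = ?T s'"
    have translate: "u = v" if "(x + u) mod m = (x + v) mod m" "0 \<le> u" "u < m" "0 \<le> v" "v < m" for x u v m :: int
    proof -
      have "(x + u - x) mod m = (x + v - x) mod m" using that(1) by (rule mod_diff_cong) simp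
      then show ?thesis using that by simp
    qed
    obtain s1 s2 s1' s2' where eq: "s = (s1, s2)" "s' = (s1', s2')" by (cases s; cases s') blast
    have "s1 = s1'"
      by (rule translate[of x1 s1 "int a"]) (use s gV eq in auto)
    moreover have "s2 = s2'"
      by (rule translate[of x2 s2 "int b"]) (use s gV eq in auto)
    ultimately show "s = s'" by (simp add: eq)
  qed
  have TV: "?T ` torus_gens a b \<subseteq> ?V"
    using assms by (auto simp: carrier_torus)
  have K: "torus_kernel a b (x1, x2) y = (if y \<in> ?T ` torus_gens a b then 1 / ?c else 0)" for y
    unfolding torus_kernel_def walk_kernel_def
    by (rule if_cong) (force simp: mult_torus)+
  have "(\<Sum>y\<in>?V. torus_kernel a b (x1, x2) y *\<^sub>R f y) = (\<Sum>y\<in>?T ` torus_gens a b. (1 / ?c) *\<^sub>R f y)"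
    using TV torus_finite_nonempty[OF assms(1,2)]
    by (intro sum.mono_neutral_cong_right) (auto simp: K)
  also have "\<dots> = (1 / ?c) *\<^sub>R (\<Sum>s\<in>torus_gens a b. f (?T s))"
    by (simp add: sum.reindex[OF inj] scaleR_sum_right)
  also have "(\<Sum>s\<in>torus_gens a b. f (?T s))
      = (\<Sum>s\<in>?A \<times> {0}. f (?T s)) + (\<Sum>s\<in>{0} \<times> ?B. f (?T s))"
    unfolding gens by (rule sum.union_disjoint[OF _ _ disj]) auto
  also have "(\<Sum>s\<in>?A \<times> {0}. f (?T s)) = (\<Sum>s\<in>?A. f (?T (s, 0)))"
    by (rule sum.reindex_bij_witness[of _ "\<lambda>s. (s, 0)" fst]) auto
  also have "\<dots> = (cycle_degree a / 2) *\<^sub>R (f ((x1 + 1) mod int a, x2) + f ((x1 - 1) mod int a, x2))"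
    using x by (subst cycle_steps(2)[OF assms(1)]) (simp add: mod_simps)
  also have "(\<Sum>s\<in>{0} \<times> ?B. f (?T s)) = (\<Sum>s\<in>?B. f (?T (0, s)))"
    by (rule sum.reindex_bij_witness[of _ "\<lambda>s. (0, s)" snd]) auto
  also have "\<dots> = (cycle_degree b / 2) *\<^sub>R (f (x1, (x2 + 1) mod int b) + f (x1, (x2 - 1) mod int b))"
    using x by (subst cycle_steps(2)[OF assms(2)]) (simp add: mod_simps)
  finally show ?thesis
    unfolding c axis_weight_def by (simp add: scaleR_add_right add.commute)
qed

definition cycle_char :: "nat \<Rightarrow> nat \<Rightarrow> int \<Rightarrow> complex" where
  "cycle_char n k x = cis (2 * pi * (real k * real_of_int x / real n))"

lemma cycle_char_mod:
  assumes "n \<ge> 1"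
  shows "cycle_char n k (x mod int n) = cycle_char n k x"
proof -
  have "real_of_int x = real n * real_of_int (x div int n) + real_of_int (x mod int n)"
    by (metis mult_div_mod_eq of_int_add of_int_mult of_int_of_nat_eq)
  then have "2 * pi * (real k * real_of_int x / real n)
      = 2 * pi * (real k * real_of_int (x div int n)) + 2 * pi * (real k * real_of_int (x mod int n) / real n)"
    using assms by (simp add: field_simps)
  then show ?thesis
    unfolding cycle_char_def by (simp add: cis_mult[symmetric])
qed

lemma cycle_char_neighbours:
  "cycle_char n k (x + 1) + cycle_char n k (x - 1) = of_real (2 * cos (2 * pi * (real k / real n))) * cycle_char n k x"
proof -
  let ?u = "2 * pi * (real k * real_of_int x / real n)" and ?v = "2 * pi * (real k / real n)"
  have "2 * pi * (real k * real_of_int (x + 1) / real n) = ?u + ?v"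
    "2 * pi * (real k * real_of_int (x - 1) / real n) = ?u - ?v"
    by (simp_all add: add_divide_distrib diff_divide_distrib algebra_simps)
  then show ?thesis
    unfolding cycle_char_def by (simp add: complex_eq_iff cos_add cos_diff sin_add sin_diff)
qed

text \<open>A geometric sum over the powers of an \<open>n\<close>-th root of unity, which is \<open>1\<close> only for \<open>x = y\<close>.\<close>

lemma cycle_char_completeness:
  assumes "x \<in> {0..<int n}" "y \<in> {0..<int n}"
  shows "(\<Sum>k<n. cycle_char n k x * cnj (cycle_char n k y)) = (if x = y then of_nat n else 0)"
proof -
  have n: "n \<ge> 1" using assms by auto
  define z where "z = cis (2 * pi * (real_of_int (x - y) / real n))"
  have "cycle_char n k x * cnj (cycle_char n k y) = z ^ k" for k
    unfolding cycle_char_def z_def cis_cnj Complex.DeMoivre cis_mult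
    by (simp add: diff_divide_distrib algebra_simps)
  then have "(\<Sum>k<n. cycle_char n k x * cnj (cycle_char n k y)) = (\<Sum>k<n. z ^ k)" by simp
  also have "\<dots> = (if x = y then of_nat n else 0)"
  proof (cases "x = y")
    case True
    then show ?thesis by (simp add: z_def)
  next
    case False
    have "z \<noteq> 1"
    proof
      assume "z = 1"
      then have "cos (2 * pi * (real_of_int (x - y) / real n)) = 1"
        by (simp add: z_def complex_eq_iff)
      then obtain m :: int where "2 * pi * (real_of_int (x - y) / real n) = of_int m * 2 * pi"
        using cos_one_2pi_int by blast
      then have "(2 * pi) * (real_of_int (x - y) / real n) = (2 * pi) * of_int m" by (simp only: mult_ac)
      then have "real_of_int (x - y) / real n = of_int m" by (subst (asm) mult_cancel_left) simp
      then have "real_of_int (x - y) = real_of_int (m * int n)" using n by (simp add: field_simps)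
      then have d: "x - y = m * int n" by linarith
      have "\<bar>x - y\<bar> < int n" using assms by auto
      then have "\<bar>m\<bar> * int n < 1 * int n" by (simp add: d abs_mult)
      then have "m = 0" by (simp only: mult_less_cancel_right) auto
      then show False using d False by simp
    qed
    moreover have "z ^ n = 1"
    proof -
      have "z ^ n = cis (2 * pi * real_of_int (x - y))"
        unfolding z_def Complex.DeMoivre using n by simp
      then show ?thesis by (simp only: cis_multiple_2pi Ints_of_int)
    qed
    ultimately show ?thesis using False by (simp add: sum_gp_strict)
  qed
  finally show ?thesis .
qed

definition torus_char :: "nat \<Rightarrow> nat \<Rightarrow> nat \<times> nat \<Rightarrow> int \<times> int \<Rightarrow> complex" where
  "torus_char a b \<xi> x = cycle_char a (fst \<xi>) (fst x) * cycle_char b (snd \<xi>) (snd x)"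

definition torus_eigenvalue :: "nat \<Rightarrow> nat \<Rightarrow> nat \<times> nat \<Rightarrow> real" where
  "torus_eigenvalue a b \<xi> = axis_weight a b * cos (2 * pi * (real (fst \<xi>) / real a))
    + axis_weight b a * cos (2 * pi * (real (snd \<xi>) / real b))"

lemma torus_eigenbasis:
  assumes "a \<ge> 2" "b \<ge> 2"
  shows "unimodular_eigenbasis (carrier (torus a b)) (torus_kernel a b) ({..<a} \<times> {..<b})
    (torus_char a b) (torus_eigenvalue a b) (0, 0)"
proof
  fix x y assume "x \<in> carrier (torus a b)" "y \<in> carrier (torus a b)"
  then have xy: "fst x \<in> {0..<int a}" "snd x \<in> {0..<int b}" "fst y \<in> {0..<int a}" "snd y \<in> {0..<int b}"
    using assms by (auto simp: carrier_torus)
  have "(\<Sum>\<xi>\<in>{..<a} \<times> {..<b}. torus_char a b \<xi> x * cnj (torus_char a b \<xi> y))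
      = (\<Sum>j<a. cycle_char a j (fst x) * cnj (cycle_char a j (fst y)))
        * (\<Sum>k<b. cycle_char b k (snd x) * cnj (cycle_char b k (snd y)))"
    unfolding sum_product sum.cartesian_product torus_char_def by (simp add: case_prod_unfold mult_ac)
  then show "(\<Sum>\<xi>\<in>{..<a} \<times> {..<b}. torus_char a b \<xi> x * cnj (torus_char a b \<xi> y))
      = (if x = y then of_nat (card (carrier (torus a b))) else 0)"
    unfolding cycle_char_completeness[OF xy(1,3)] cycle_char_completeness[OF xy(2,4)]
    using assms by (auto simp: card_torus prod_eq_iff)
next
  fix \<xi> :: "nat \<times> nat" and x assume "x \<in> carrier (torus a b)"
  then obtain x1 x2 where x: "x = (x1, x2)" and xx: "x1 \<in> {0..<int a}" "x2 \<in> {0..<int b}"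
    using assms by (auto simp: carrier_torus)
  obtain j k where \<xi>: "\<xi> = (j, k)" by fastforce
  let ?f = "\<lambda>y. torus_char a b \<xi> y"
  have "(\<Sum>y\<in>carrier (torus a b). of_real (torus_kernel a b x y) * ?f y)
      = (axis_weight a b / 2) *\<^sub>R (?f ((x1 + 1) mod int a, x2) + ?f ((x1 - 1) mod int a, x2))
      + (axis_weight b a / 2) *\<^sub>R (?f (x1, (x2 + 1) mod int b) + ?f (x1, (x2 - 1) mod int b))"
    using sum_torus_kernel[OF assms xx, of ?f] by (simp add: x scaleR_conv_of_real)
  also have "\<dots> = (axis_weight a b / 2) *\<^sub>R ((cycle_char a j (x1 + 1) + cycle_char a j (x1 - 1)) * cycle_char b k x2)
      + (axis_weight b a / 2) *\<^sub>R (cycle_char a j x1 * (cycle_char b k (x2 + 1) + cycle_char b k (x2 - 1)))"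
    using assms by (simp add: torus_char_def \<xi> cycle_char_mod algebra_simps)
  also have "\<dots> = of_real (torus_eigenvalue a b \<xi>) * ?f x"
    unfolding cycle_char_neighbours
    by (simp add: torus_char_def torus_eigenvalue_def \<xi> x scaleR_conv_of_real algebra_simps)
  finally show "(\<Sum>y\<in>carrier (torus a b). of_real (torus_kernel a b x y) * ?f y)
      = of_real (torus_eigenvalue a b \<xi>) * ?f x" .
next
  show "torus_eigenvalue a b (0, 0) = 1"
    using axis_weight_sum[of a b] by (simp add: torus_eigenvalue_def)
  show "finite (carrier (torus a b))" "carrier (torus a b) \<noteq> {}"
    by (rule torus_finite_nonempty[OF assms])+
  show "(0, 0) \<in> {..<a} \<times> {..<b}" using assms by simp
qed (simp_all add: torus_char_def norm_mult cycle_char_def)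

lemma torus_gap_eq:
  "1 - torus_eigenvalue a b \<xi> = axis_weight a b * (1 - cos (2 * pi * (real (fst \<xi>) / real a)))
    + axis_weight b a * (1 - cos (2 * pi * (real (snd \<xi>) / real b)))"
  using axis_weight_sum[of a b] by (simp add: torus_eigenvalue_def algebra_simps)

text \<open>The exponent is a sum over the two coordinates, so the trace of the torus factorises.\<close>

lemma torus_heat_trace:
  "(\<Sum>\<xi>\<in>{..<a} \<times> {..<b}. exp (- t * (1 - torus_eigenvalue a b \<xi>)))
    = cycle_trace a (axis_weight a b * t) * cycle_trace b (axis_weight b a * t)"
  unfolding torus_gap_eq cycle_trace_def sum_product sum.cartesian_product
  by (intro sum.cong refl) (auto simp: exp_add[symmetric] algebra_simps)

lemma torus_eigenvalue_le_1: "torus_eigenvalue a b \<xi> \<le> 1"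
proof -
  have "0 \<le> 1 - torus_eigenvalue a b \<xi>"
    unfolding torus_gap_eq using axis_weight_ge[of a b] axis_weight_ge[of b a]
    by (intro add_nonneg_nonneg mult_nonneg_nonneg) auto
  then show ?thesis by simp
qed

lemma torus_dist_eq:
  assumes "a \<ge> 2" "b \<ge> 2"
  shows "torus_dist a b t
    = cycle_trace a (axis_weight a b * t) * cycle_trace b (axis_weight b a * t) - 1"
proof -
  interpret unimodular_eigenbasis "carrier (torus a b)" "torus_kernel a b" "{..<a} \<times> {..<b}"
    "torus_char a b" "torus_eigenvalue a b" "(0, 0)"
    by (rule torus_eigenbasis[OF assms])
  show ?thesis
    unfolding torus_dist_def torus_pi_def d_infinity_spectral torus_heat_trace[symmetric]
    using finite_X trivial_in trivial_kappa by (simp add: sum_diff1)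
qed

text \<open>A non-trivial frequency is non-zero in one coordinate; that side has weight at least \<open>1/3\<close> and length
  at most \<open>b\<close>.\<close>

lemma torus_spectral_gap:
  assumes "2 \<le> a" "a \<le> b" "\<xi> \<in> {..<a} \<times> {..<b} - {(0, 0)}"
  shows "1 / (real b)\<^sup>2 \<le> 1 - torus_eigenvalue a b \<xi>"
proof -
  have gap: "3 / (real b)\<^sup>2 \<le> 1 - cos (2 * pi * (real k / real n))"
    if "2 \<le> n" "n \<le> b" "k \<in> {1..<n}" for k n
  proof -
    have "4 * (1 / real n)\<^sup>2 \<le> 1 - cos (2 * pi * (real k / real n))"
      by (rule cycle_gap_ge[OF that(3)])
    moreover have "(1 / real b)\<^sup>2 \<le> (1 / real n)\<^sup>2"
      using that by (intro power_mono) (auto simp: field_simps)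
    ultimately have "3 * (1 / real b)\<^sup>2 \<le> 1 - cos (2 * pi * (real k / real n))"
      using zero_le_power2[of "1 / real b"] by linarith
    then show ?thesis by (simp add: power_divide)
  qed
  obtain j k where \<xi>: "\<xi> = (j, k)" "j < a" "k < b" "j \<ge> 1 \<or> k \<ge> 1"
    using assms by (cases \<xi>) fastforce
  have w: "axis_weight a b \<ge> 1 / 3" "axis_weight b a \<ge> 1 / 3" by (rule axis_weight_ge)+
  from \<xi>(4) show ?thesis
  proof
    assume "j \<ge> 1"
    then have "1 / 3 * (3 / (real b)\<^sup>2) \<le> axis_weight a b * (1 - cos (2 * pi * (real j / real a)))"
      using w \<xi> assms by (intro mult_mono gap) auto
    moreover have "0 \<le> axis_weight b a * (1 - cos (2 * pi * (real k / real b)))"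
      using w by (intro mult_nonneg_nonneg) auto
    ultimately show ?thesis unfolding torus_gap_eq \<xi> by simp
  next
    assume "k \<ge> 1"
    then have "1 / 3 * (3 / (real b)\<^sup>2) \<le> axis_weight b a * (1 - cos (2 * pi * (real k / real b)))"
      using w \<xi> assms by (intro mult_mono gap) auto
    moreover have "0 \<le> axis_weight a b * (1 - cos (2 * pi * (real j / real a)))"
      using w by (intro mult_nonneg_nonneg) auto
    ultimately show ?thesis unfolding torus_gap_eq \<xi> by simp
  qed
qed

section \<open>The uniform distance of the heat kernel to equilibrium\<close>

text \<open>The weights lie between \<open>1/3\<close> and \<open>1\<close>, so replacing \<open>axis_weight a b * t\<close> by \<open>t\<close> or \<open>t/3\<close> frees
  the trace of its dependence on the degenerate cases.\<close>

lemma cycle_trace_axis_weight: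
  assumes "n \<ge> 1" "t \<ge> 0"
  shows "cycle_trace n t \<le> cycle_trace n (axis_weight a b * t)"
    and "cycle_trace n (axis_weight a b * t) \<le> cycle_trace n (t / 3)"
proof -
  have "axis_weight a b \<le> 1" "axis_weight a b \<ge> 1 / 3"
    using axis_weight_sum[of a b] axis_weight_ge[of a b] axis_weight_ge[of b a] by linarith+
  then have "axis_weight a b * t \<le> 1 * t" "1 / 3 * t \<le> axis_weight a b * t"
    using assms by (intro mult_right_mono; simp)+
  then show "cycle_trace n t \<le> cycle_trace n (axis_weight a b * t)"
    "cycle_trace n (axis_weight a b * t) \<le> cycle_trace n (t / 3)"
    by (intro cycle_trace_antimono; simp)+
qed

lemma cycle_trace_third_upper:
  assumes "n \<ge> 1" "t \<ge> 0"
  shows "cycle_trace n (t / 3) \<le> 1 + 8 * (real n / sqrt (t + 1))"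
proof -
  have "sqrt (t + 1) \<le> sqrt (4 * (t / 3 + 1))" using assms by (intro real_sqrt_le_mono) simp
  then have le: "sqrt (t + 1) \<le> 2 * sqrt (t / 3 + 1)" by (simp only: real_sqrt_mult) simp
  have "4 * real n / sqrt (t / 3 + 1) = 8 * real n / (2 * sqrt (t / 3 + 1))" by simp
  also have "\<dots> \<le> 8 * real n / sqrt (t + 1)"
    using assms le by (intro divide_left_mono mult_pos_pos) auto
  finally show ?thesis using cycle_trace_upper[of n "t / 3"] assms by simp
qed

lemma torus_trace_upper:
  assumes "a \<ge> 2" "b \<ge> 2" "t \<ge> 0"
  shows "cycle_trace a (axis_weight a b * t) * cycle_trace b (axis_weight b a * t)
    \<le> (1 + 8 * (real a / sqrt (t + 1))) * (1 + 8 * (real b / sqrt (t + 1)))"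
proof (intro mult_mono)
  show "cycle_trace a (axis_weight a b * t) \<le> 1 + 8 * (real a / sqrt (t + 1))"
    using assms cycle_trace_axis_weight(2)[of a t a b] cycle_trace_third_upper[of a t] by simp
  show "cycle_trace b (axis_weight b a * t) \<le> 1 + 8 * (real b / sqrt (t + 1))"
    using assms cycle_trace_axis_weight(2)[of b t b a] cycle_trace_third_upper[of b t] by simp
  show "0 \<le> cycle_trace b (axis_weight b a * t)"
    using assms cycle_trace_ge_1[of b "axis_weight b a * t"] by simp
qed (use assms in simp)

lemma torus_dist_upper:
  assumes "a \<ge> 2" "b \<ge> 2" "t \<ge> 0"
  shows "torus_dist a b t \<le> (1 + 8 * (real a / sqrt (t + 1))) * (1 + 8 * (real b / sqrt (t + 1)))"
  using torus_trace_upper[OF assms] torus_dist_eq[OF assms(1,2), of t] by simp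

text \<open>Both bounds drop part of the non-trivial frequencies: the first keeps those that are non-zero in
  both coordinates, the second those that vary only along the side of length \<open>b\<close>.\<close>

lemma torus_dist_lower:
  assumes "a \<ge> 2" "b \<ge> 2" "t \<ge> 0"
  shows "(cycle_trace a t - 1) * (cycle_trace b t - 1) \<le> torus_dist a b t"
    and "cycle_trace b t - 1 \<le> torus_dist a b t"
proof -
  have 1: "cycle_trace a t \<ge> 1" "cycle_trace b t \<ge> 1"
    using assms by (auto intro: cycle_trace_ge_1)
  have "cycle_trace a t * cycle_trace b t
      \<le> cycle_trace a (axis_weight a b * t) * cycle_trace b (axis_weight b a * t)"
    using assms 1 by (intro mult_mono cycle_trace_axis_weight(1))
      (auto intro: order_trans[OF zero_le_one cycle_trace_ge_1])
  then have le: "cycle_trace a t * cycle_trace b t - 1 \<le> torus_dist a b t"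
    using torus_dist_eq[OF assms(1,2)] by simp
  have "(cycle_trace a t - 1) * (cycle_trace b t - 1) \<le> cycle_trace a t * cycle_trace b t - 1"
    using 1 by (simp add: algebra_simps)
  with le show "(cycle_trace a t - 1) * (cycle_trace b t - 1) \<le> torus_dist a b t" by linarith
  have "1 * cycle_trace b t \<le> cycle_trace a t * cycle_trace b t"
    using 1 by (intro mult_right_mono) auto
  with le show "cycle_trace b t - 1 \<le> torus_dist a b t" by linarith
qed

text \<open>Neither side is mixed, so both traces are of order \<open>n/\<surd>(t + 1)\<close>.\<close>

lemma torus_dist_short_time:
  "comparable_on {(a, b, t). 2 \<le> a \<and> a \<le> b \<and> 0 \<le> t \<and> t \<le> (real a)\<^sup>2}
     (\<lambda>(a, b, t). torus_dist a b t) (\<lambda>(a, b, t). real a * real b / (t + 1))"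
proof -
  define c where "c = exp (- 180 :: real) / 2"
  have c: "c > 0" by (simp add: c_def)
  have "torus_dist a b t \<le> 100 * (real a * real b / (t + 1))
      \<and> real a * real b / (t + 1) \<le> 1 / c\<^sup>2 * torus_dist a b t"
    if "2 \<le> a" "a \<le> b" "0 \<le> t" "t \<le> (real a)\<^sup>2" for a b t
  proof
    let ?x = "real a / sqrt (t + 1)" and ?y = "real b / sqrt (t + 1)"
    have b: "b \<ge> 2" using that by simp
    have xy: "?x * ?y = real a * real b / (t + 1)" using that by simp
    have "(real a)\<^sup>2 \<le> (real b)\<^sup>2" using that by (intro power_mono) auto
    then have tb: "t \<le> (real b)\<^sup>2" using that by linarith
    have "1 / 2 \<le> ?x" "1 / 2 \<le> ?y"
      using that tb by (intro half_le_side_over_sqrt; simp)+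
    then have "(1 + 8 * ?x) * (1 + 8 * ?y) \<le> (10 * ?x) * (10 * ?y)"
      by (intro mult_mono) auto
    then show "torus_dist a b t \<le> 100 * (real a * real b / (t + 1))"
      using torus_dist_upper[OF that(1) b that(3)] by (simp add: xy[symmetric])
    have "(c * ?x) * (c * ?y) \<le> (cycle_trace a t - 1) * (cycle_trace b t - 1)"
      using that tb b unfolding c_def by (intro mult_mono cycle_trace_lower) (auto simp: cycle_trace_ge_1)
    also have "\<dots> \<le> torus_dist a b t"
      using that b by (intro torus_dist_lower) auto
    finally have "c\<^sup>2 * (?x * ?y) \<le> torus_dist a b t" by (simp add: power2_eq_square mult_ac)
    then show "real a * real b / (t + 1) \<le> 1 / c\<^sup>2 * torus_dist a b t"
      unfolding xy using c by (simp add: field_simps)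
  qed
  moreover have "1 / c\<^sup>2 > 0" using c by simp
  ultimately show ?thesis
    unfolding comparable_on_def preceq_on_def
    by (intro conjI exI[of _ 100] exI[of _ "1 / c\<^sup>2"]) auto
qed

text \<open>The short side is mixed and its trace is bounded; the long side alone determines the distance.\<close>

lemma torus_dist_medium_time:
  "comparable_on {(a, b, t). 2 \<le> a \<and> a \<le> b \<and> (real a)\<^sup>2 \<le> t \<and> t \<le> (real b)\<^sup>2}
     (\<lambda>(a, b, t). torus_dist a b t) (\<lambda>(a, b, t). real b / sqrt t)"
proof -
  define c where "c = exp (- 180 :: real) / 2"
  have c: "c > 0" by (simp add: c_def)
  have "torus_dist a b t \<le> 90 * (real b / sqrt t)
      \<and> real b / sqrt t \<le> 2 / c * torus_dist a b t"
    if "2 \<le> a" "a \<le> b" "(real a)\<^sup>2 \<le> t" "t \<le> (real b)\<^sup>2" for a b t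
  proof
    let ?x = "real a / sqrt (t + 1)" and ?y = "real b / sqrt (t + 1)"
    have b: "b \<ge> 2" using that by simp
    have "2\<^sup>2 \<le> (real a)\<^sup>2" using that by (intro power_mono) auto
    then have t: "t \<ge> 4" using that by simp
    have "real a \<le> sqrt (t + 1)" using that by (intro real_le_rsqrt) simp
    then have x: "?x \<le> 1" using t by simp
    have y: "1 / 2 \<le> ?y"
      using that t by (intro half_le_side_over_sqrt; simp)
    have "?y \<le> real b / sqrt t" using t by (intro divide_left_mono) auto
    moreover have "(1 + 8 * ?x) * (1 + 8 * ?y) \<le> 9 * (10 * ?y)"
    proof (intro mult_mono)
      show "1 + 8 * ?x \<le> 9" "1 + 8 * ?y \<le> 10 * ?y" using x y by linarith+
    qed (use t in auto)
    moreover have "torus_dist a b t \<le> (1 + 8 * ?x) * (1 + 8 * ?y)"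
      using that b t by (intro torus_dist_upper) auto
    ultimately show "torus_dist a b t \<le> 90 * (real b / sqrt t)" by linarith
    have "sqrt (t + 1) \<le> sqrt (4 * t)" using t by (intro real_sqrt_le_mono) simp
    then have "sqrt (t + 1) \<le> 2 * sqrt t" by (simp only: real_sqrt_mult) simp
    then have "real b / (2 * sqrt t) \<le> ?y" using t by (intro divide_left_mono) auto
    then have "c * (real b / (2 * sqrt t)) \<le> c * ?y" using c by (intro mult_left_mono) auto
    also have "\<dots> \<le> cycle_trace b t - 1"
      using that b t unfolding c_def by (intro cycle_trace_lower) auto
    also have "\<dots> \<le> torus_dist a b t"
      using that b t by (intro torus_dist_lower) auto
    finally show "real b / sqrt t \<le> 2 / c * torus_dist a b t"
      using c t by (simp add: field_simps)
  qed
  moreover have "2 / c > 0" using c by simp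
  ultimately show ?thesis
    unfolding comparable_on_def preceq_on_def
    by (intro conjI exI[of _ 90] exI[of _ "2 / c"]) auto
qed

lemma torus_dist_long_time:
  "preceq_on {(a, b, t). 2 \<le> a \<and> a \<le> b \<and> (real b)\<^sup>2 \<le> t}
     (\<lambda>(a, b, t). exp (- 20 * t / (real b)\<^sup>2)) (\<lambda>(a, b, t). torus_dist a b t)"
  "preceq_on {(a, b, t). 2 \<le> a \<and> a \<le> b \<and> (real b)\<^sup>2 \<le> t}
     (\<lambda>(a, b, t). torus_dist a b t) (\<lambda>(a, b, t). exp (- (1 / 3) * t / (real b)\<^sup>2))"
proof -
  have lower: "exp (- 20 * t / (real b)\<^sup>2) \<le> 1 * torus_dist a b t"
    if "2 \<le> a" "a \<le> b" "(real b)\<^sup>2 \<le> t" for a b t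
  proof -
    have "t \<ge> 0" using that(3) zero_le_power2[of "real b"] by linarith
    then have "exp (- 20 * t / (real b)\<^sup>2) \<le> cycle_trace b t - 1" "cycle_trace b t - 1 \<le> torus_dist a b t"
      using that by (intro cycle_trace_lower_exp torus_dist_lower; simp)+
    then show ?thesis by simp
  qed
  have upper: "torus_dist a b t \<le> 60 * exp (- (1 / 3) * t / (real b)\<^sup>2)"
    if "2 \<le> a" "a \<le> b" "(real b)\<^sup>2 \<le> t" for a b t
  proof -
    have t: "t \<ge> 0" using that(3) zero_le_power2[of "real b"] by linarith
    have ab: "(real a)\<^sup>2 \<le> (real b)\<^sup>2" using that by (intro power_mono) auto
    let ?A = "cycle_trace a (axis_weight a b * t)" and ?B = "cycle_trace b (axis_weight b a * t)"
    let ?e = "exp (- (1 / 3) * t / (real b)\<^sup>2)"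
    have "?A - 1 \<le> 6 * exp (- (t / 3) / (real a)\<^sup>2)"
      using that t ab cycle_trace_axis_weight(2)[of a t a b] cycle_trace_upper_exp[of a "t / 3"]
        order_trans[OF ab that(3)] by simp
    also have "exp (- (t / 3) / (real a)\<^sup>2) \<le> ?e"
      using that t ab by (simp add: divide_left_mono)
    finally have A: "?A - 1 \<le> 6 * ?e" by simp
    have B: "?B - 1 \<le> 6 * ?e"
      using that t cycle_trace_axis_weight(2)[of b t b a] cycle_trace_upper_exp[of b "t / 3"] by simp
    have "?e \<le> 1" using t by simp
    then have "?B \<le> 7" using B by linarith
    then have "(?A - 1) * ?B \<le> (6 * ?e) * 7"
      using A that cycle_trace_ge_1[of a] cycle_trace_ge_1[of b "axis_weight b a * t"]
      by (intro mult_mono) auto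
    then have "?A * ?B - 1 \<le> 48 * ?e" using B by (simp add: algebra_simps)
    then show ?thesis using torus_dist_eq[of a b t] that exp_gt_zero[of "- (1 / 3) * t / (real b)\<^sup>2"] by linarith
  qed
  show "preceq_on {(a, b, t). 2 \<le> a \<and> a \<le> b \<and> (real b)\<^sup>2 \<le> t}
     (\<lambda>(a, b, t). exp (- 20 * t / (real b)\<^sup>2)) (\<lambda>(a, b, t). torus_dist a b t)"
    unfolding preceq_on_def by (rule exI[of _ 1]) (use lower in auto)
  show "preceq_on {(a, b, t). 2 \<le> a \<and> a \<le> b \<and> (real b)\<^sup>2 \<le> t}
     (\<lambda>(a, b, t). torus_dist a b t) (\<lambda>(a, b, t). exp (- (1 / 3) * t / (real b)\<^sup>2))"
    unfolding preceq_on_def by (rule exI[of _ 60]) (use upper in auto)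
qed

section \<open>Lower bounds for the spectral profile\<close>

lemma torus_profile_ge_gap:
  assumes "2 \<le> a" "a \<le> b" "1 / (real a * real b) \<le> v"
  shows "1 / (real b)\<^sup>2 \<le> torus_profile a b v"
proof -
  have b: "b \<ge> 2" using assms by simp
  interpret unimodular_eigenbasis "carrier (torus a b)" "torus_kernel a b" "{..<a} \<times> {..<b}"
    "torus_char a b" "torus_eigenvalue a b" "(0, 0)"
    by (rule torus_eigenbasis[OF assms(1) b])
  have "2 * 2 \<le> a * b" using assms b by (intro mult_mono) auto
  then have "card (carrier (torus a b)) \<ge> 2" by (simp add: card_torus[OF assms(1) b])
  moreover have "1 \<le> v * card (carrier (torus a b))"
    using assms b by (simp add: card_torus field_simps)
  ultimately show ?thesis
    unfolding torus_profile_def torus_pi_def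
    by (intro spectral_profile_uniform_ge finite_V poincare_inequality torus_spectral_gap assms)
qed

text \<open>The Nash inequality at time \<open>t = (64 \<rho>)\<^sup>2\<close>. The hypothesis \<open>small\<close> bounds the heat trace times the
  volume by \<open>1/2\<close>, so that the \<open>1\<close>-norm term is absorbed by the left-hand side.\<close>

lemma torus_profile_ge_scale:
  fixes \<rho> v :: real
  assumes "2 \<le> a" "a \<le> b" "1 / (real a * real b) \<le> v" "\<rho> > 0"
    and small: "(1 + real a / (8 * \<rho>)) * (1 + real b / (8 * \<rho>)) * v \<le> 1 / 2"
  shows "1 / (8192 * \<rho>\<^sup>2) \<le> torus_profile a b v"
proof -
  have b: "b \<ge> 2" using assms by simp
  interpret unimodular_eigenbasis "carrier (torus a b)" "torus_kernel a b" "{..<a} \<times> {..<b}"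
    "torus_char a b" "torus_eigenvalue a b" "(0, 0)"
    by (rule torus_eigenbasis[OF assms(1) b])
  let ?V = "carrier (torus a b)"
  define N where "N = real (card ?V)"
  have N: "N > 0" using card_V_pos by (simp add: N_def)
  \<comment> \<open>The factor \<open>64\<close> turns the term \<open>8 (x / \<surd>(t + 1))\<close> of the trace bound into \<open>x / (8 \<rho>)\<close>.\<close>
  define t where "t = (64 * \<rho>)\<^sup>2"
  have t: "t > 0" using assms by (simp add: t_def)
  define G where "G = (\<Sum>\<xi>\<in>{..<a} \<times> {..<b}. exp (- t * (1 - torus_eigenvalue a b \<xi>)))"
  have v: "v > 0" using assms b by (smt (verit) divide_pos_pos mult_pos_pos of_nat_0_less_iff less_le_trans zero_less_numeral)
  have Gv: "G * v \<le> 1 / 2"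
  proof -
    have s: "64 * \<rho> \<le> sqrt (t + 1)" using assms by (intro real_le_rsqrt) (simp add: t_def)
    have le: "8 * (x / sqrt (t + 1)) \<le> x / (8 * \<rho>)" if "x \<ge> 0" for x
    proof -
      have "x / sqrt (t + 1) \<le> x / (64 * \<rho>)"
        using s assms t that by (intro divide_left_mono) auto
      then show ?thesis by simp
    qed
    have "G \<le> (1 + 8 * (real a / sqrt (t + 1))) * (1 + 8 * (real b / sqrt (t + 1)))"
      unfolding G_def torus_heat_trace using assms b t by (intro torus_trace_upper) auto
    also have "\<dots> \<le> (1 + real a / (8 * \<rho>)) * (1 + real b / (8 * \<rho>))"
      using assms t by (intro mult_mono add_left_mono le) auto
    finally have "G * v \<le> (1 + real a / (8 * \<rho>)) * (1 + real b / (8 * \<rho>)) * v"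
      using v by (intro mult_right_mono) auto
    then show ?thesis using small by linarith
  qed
  have "2 * 2 \<le> a * b" using assms b by (intro mult_mono) auto
  then have card: "card (carrier (torus a b)) \<ge> 2" by (simp add: card_torus[OF assms(1) b])
  have r: "1 \<le> v * card (carrier (torus a b))"
    using assms b by (simp add: card_torus field_simps)
  have "1 / (8192 * \<rho>\<^sup>2) = 1 / (2 * t)" by (simp add: t_def power_mult_distrib)
  moreover have "1 / (2 * t) \<le> torus_profile a b v"
    unfolding torus_profile_def torus_pi_def
  proof (intro spectral_profile_uniform_ge finite_V card r)
    fix S f assume S: "S \<subseteq> ?V" "card S \<le> v * card ?V" and f: "f \<in> c0_plus ?V S"
    define Q where "Q = (\<Sum>x\<in>?V. (f x)\<^sup>2)"
    define E where "E = (\<Sum>x\<in>?V. (f x - (\<Sum>y\<in>?V. torus_kernel a b x y * f y)) * f x)"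
    have Q0: "Q \<ge> 0" by (simp add: Q_def sum_nonneg)
    have abs: "(\<Sum>x\<in>?V. \<bar>f x\<bar>) = (\<Sum>x\<in>?V. f x)"
      using f by (intro sum.cong) (auto simp: c0_plus_def)
    have G0: "G \<ge> 0" by (simp add: G_def sum_nonneg)
    have "(\<Sum>x\<in>?V. f x)\<^sup>2 \<le> card S * Q"
      unfolding Q_def using f S(1) by (intro sum_squared_le_card_support finite_V) (auto simp: c0_plus_def)
    also have "\<dots> \<le> (v * N) * Q"
      using S(2) Q0 by (intro mult_right_mono) (auto simp: N_def)
    finally have "G * (\<Sum>x\<in>?V. f x)\<^sup>2 \<le> G * ((v * N) * Q)"
      using G0 by (intro mult_left_mono)
    also have "\<dots> = (G * v) * (N * Q)" by simp
    also have "\<dots> \<le> 1 / 2 * (N * Q)"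
      using Gv N Q0 by (intro mult_right_mono) auto
    finally have "N * Q \<le> 1 / 2 * (N * Q) + t * (N * E)"
      using nash_inequality[OF less_imp_le[OF t] torus_eigenvalue_le_1, of f]
      unfolding abs N_def[symmetric] Q_def[symmetric] E_def[symmetric] G_def[symmetric] by linarith
    then have "N * Q \<le> N * (2 * t * E)" by (simp add: field_simps)
    then have QE: "Q \<le> 2 * t * E" using N by simp
    have "measure_pmf.variance (pmf_of_set ?V) f \<le> Q / N"
      unfolding variance_uniform[OF finite_V V_nonempty] Q_def N_def by simp
    also have "\<dots> \<le> 2 * t * E / N" using QE N by (intro divide_right_mono) auto
    also have "\<dots> = 2 * t * dirichlet_form ?V (torus_kernel a b) (pmf_of_set ?V) f f"
      unfolding dirichlet_form_uniform[OF finite_V V_nonempty] E_def N_def by simp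
    finally show "1 / (2 * t) * measure_pmf.variance (pmf_of_set ?V) f
        \<le> dirichlet_form ?V (torus_kernel a b) (pmf_of_set ?V) f f"
      using t by (simp add: field_simps)
  qed
  ultimately show ?thesis by (simp only:)
qed

section \<open>Upper bounds for the spectral profile\<close>

text \<open>Products of supersolutions on the two cycles are supersolutions on the torus, because the step of
  the walk is an average, with weights summing to \<open>1\<close>, of the steps along the sides.\<close>

lemma torus_profile_product_le:
  fixes g h :: "int \<Rightarrow> real"
  assumes a: "a \<ge> 2" and b: "b \<ge> 2"
    and A: "A \<subseteq> {0..<int a}" and B: "B \<subseteq> {0..<int b}"
    and card: "real (card A * card B) \<le> v * (real a * real b)" "real (card A * card B) \<le> real a * real b / 2"
    and g: "\<And>x. g x \<ge> 0" "\<And>x. x \<in> {0..<int a} - A \<Longrightarrow> g x = 0"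
    and h: "\<And>y. h y \<ge> 0" "\<And>y. y \<in> {0..<int b} - B \<Longrightarrow> h y = 0"
    and z: "xz \<in> A" "g xz \<noteq> 0" "yz \<in> B" "h yz \<noteq> 0"
    and g_super: "\<And>x. x \<in> {0..<int a} \<Longrightarrow>
      2 * (1 - \<delta>) * g x \<le> g ((x + 1) mod int a) + g ((x - 1) mod int a)"
    and h_super: "\<And>y. y \<in> {0..<int b} \<Longrightarrow>
      2 * (1 - \<delta>) * h y \<le> h ((y + 1) mod int b) + h ((y - 1) mod int b)"
  shows "torus_profile a b v \<le> 2 * \<delta>"
proof -
  interpret unimodular_eigenbasis "carrier (torus a b)" "torus_kernel a b" "{..<a} \<times> {..<b}"
    "torus_char a b" "torus_eigenvalue a b" "(0, 0)"
    by (rule torus_eigenbasis[OF a b])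
  let ?V = "carrier (torus a b)" and ?f = "\<lambda>x. g (fst x) * h (snd x)"
  have V: "?V = {0..<int a} \<times> {0..<int b}" by (rule carrier_torus[OF a b])
  have "2 * 2 \<le> a * b" using a b by (intro mult_mono) auto
  then have "card ?V \<ge> 2" by (simp add: card_torus[OF a b])
  moreover have "dirichlet_form ?V (torus_kernel a b) (pmf_of_set ?V) f f \<ge> 0" for f
    unfolding dirichlet_form_uniform[OF finite_V V_nonempty]
    by (intro divide_nonneg_nonneg energy_nonneg torus_eigenvalue_le_1) auto
  moreover have "?f x - (\<Sum>y\<in>?V. torus_kernel a b x y * ?f y) \<le> \<delta> * ?f x" if "x \<in> ?V" for x
  proof -
    obtain x1 x2 where x: "x = (x1, x2)" "x1 \<in> {0..<int a}" "x2 \<in> {0..<int b}"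
      using \<open>x \<in> ?V\<close> unfolding V by auto
    let ?p = "axis_weight a b" and ?q = "axis_weight b a"
    have pq: "?p \<ge> 0" "?q \<ge> 0" "?p + ?q = 1"
      using axis_weight_ge[of a b] axis_weight_ge[of b a] axis_weight_sum by auto
    have "(\<Sum>y\<in>?V. torus_kernel a b x y * ?f y)
        = ?p / 2 * ((g ((x1 + 1) mod int a) + g ((x1 - 1) mod int a)) * h x2)
        + ?q / 2 * (g x1 * (h ((x2 + 1) mod int b) + h ((x2 - 1) mod int b)))"
      using sum_torus_kernel[OF a b x(2,3), of ?f] by (simp add: x(1) algebra_simps)
    also have "\<dots> \<ge> ?p / 2 * ((2 * (1 - \<delta>) * g x1) * h x2) + ?q / 2 * (g x1 * (2 * (1 - \<delta>) * h x2))"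
      using pq g(1) h(1) g_super[OF x(2)] h_super[OF x(3)]
      by (intro add_mono mult_left_mono mult_right_mono) auto
    also have "?p / 2 * ((2 * (1 - \<delta>) * g x1) * h x2) + ?q / 2 * (g x1 * (2 * (1 - \<delta>) * h x2))
        = (?p + ?q) * ((1 - \<delta>) * (g x1 * h x2))" by (simp add: algebra_simps)
    finally show ?thesis by (simp add: pq x(1) algebra_simps)
  qed
  moreover have "card (A \<times> B) \<le> v * card ?V" "card (A \<times> B) \<le> card ?V / 2"
    using card by (simp_all add: card_torus[OF a b] card_cartesian_product)
  moreover have "{x \<in> ?V. ?f x \<noteq> 0} \<subseteq> A \<times> B" using V g(2) h(2) by fastforce
  moreover have "A \<times> B \<subseteq> ?V" "(xz, yz) \<in> ?V" "?f (xz, yz) \<noteq> 0" using A B V z by auto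
  ultimately show ?thesis
    unfolding torus_profile_def torus_pi_def
    using g(1) h(1) by (intro spectral_profile_superharmonic_le[where S = "A \<times> B" and f = ?f and z = "(xz, yz)"] finite_V) auto
qed

text \<open>The principal Dirichlet eigenfunction of the interval \<open>{0..<r}\<close>, with zeros at \<open>-1\<close> and \<open>r\<close>,
  extended by zero.\<close>

definition sine_bump :: "nat \<Rightarrow> int \<Rightarrow> real" where
  "sine_bump r x = (if 0 \<le> x \<and> x < int r then sin (pi * (real_of_int x + 1) / (real r + 1)) else 0)"

lemma sine_bump_nonneg: "sine_bump r x \<ge> 0"
proof -
  have "0 \<le> sin (pi * (real_of_int x + 1) / (real r + 1))" if "0 \<le> x" "x < int r"
  proof (rule sin_ge_zero)
    have "real_of_int x + 1 \<le> real r + 1" using that by linarith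
    then show "pi * (real_of_int x + 1) / (real r + 1) \<le> pi" by (simp add: field_simps)
  qed (use that in simp)
  then show ?thesis by (simp add: sine_bump_def)
qed

lemma sine_bump_outside: "x \<notin> {0..<int r} \<Longrightarrow> sine_bump r x = 0"
  by (auto simp: sine_bump_def)

text \<open>Inside the interval the addition theorem gives equality with the unextended sine. At the two ends
  the sine vanishes one step outside, where the bump is non-negative. This remains true when the
  interval wraps around the whole cycle (\<open>r = n\<close>) and the neighbour outside is the opposite end.\<close>

lemma sine_bump_superharmonic:
  assumes "r \<le> n" "x \<in> {0..<int n}"
  shows "2 * cos (pi / (real r + 1)) * sine_bump r x
    \<le> sine_bump r ((x + 1) mod int n) + sine_bump r ((x - 1) mod int n)"
proof (cases "x < int r")
  case False
  then show ?thesis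
    using sine_bump_nonneg[of r "(x + 1) mod int n"] sine_bump_nonneg[of r "(x - 1) mod int n"]
    by (simp add: sine_bump_def)
next
  case True
  define \<theta> where "\<theta> = pi / (real r + 1)"
  have bump: "sine_bump r y = sin (\<theta> * (real_of_int y + 1))" if "0 \<le> y" "y < int r" for y
    using that by (simp add: sine_bump_def \<theta>_def)
  have right: "sin (\<theta> * (real_of_int x + 2)) \<le> sine_bump r ((x + 1) mod int n)"
  proof (cases "x + 1 < int r")
    case True
    then have "(x + 1) mod int n = x + 1" using assms by simp
    then show ?thesis using True assms by (simp add: bump algebra_simps)
  next
    case False
    then have "real_of_int x + 2 = real r + 1" using \<open>x < int r\<close> by linarith
    then have "\<theta> * (real_of_int x + 2) = \<theta> * (real r + 1)" by (simp only:)
    also have "\<dots> = pi" by (simp add: \<theta>_def)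
    finally have "sin (\<theta> * (real_of_int x + 2)) = 0" by simp
    then show ?thesis using sine_bump_nonneg by simp
  qed
  have left: "sin (\<theta> * real_of_int x) \<le> sine_bump r ((x - 1) mod int n)"
  proof (cases "x = 0")
    case True
    then show ?thesis using sine_bump_nonneg by simp
  next
    case False
    then have "(x - 1) mod int n = x - 1" using assms by simp
    then show ?thesis using False True assms by (simp add: bump)
  qed
  have "2 * cos \<theta> * sine_bump r x = 2 * cos \<theta> * sin (\<theta> * (real_of_int x + 1))"
    using True assms by (simp add: bump)
  also have "\<dots> = sin (\<theta> * (real_of_int x + 1) + \<theta>) + sin (\<theta> * (real_of_int x + 1) - \<theta>)"
    by (simp add: sin_add sin_diff)
  also have "\<dots> = sin (\<theta> * (real_of_int x + 2)) + sin (\<theta> * real_of_int x)"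
    by (simp add: algebra_simps)
  finally show ?thesis using left right by (simp add: \<theta>_def)
qed

lemma sine_bump_0: "r \<ge> 1 \<Longrightarrow> sine_bump r 0 \<noteq> 0"
proof -
  assume "r \<ge> 1"
  then have "0 < sin (pi / (real r + 1))"
    by (intro sin_gt_zero) (auto simp: field_simps)
  with \<open>r \<ge> 1\<close> show ?thesis by (simp add: sine_bump_def)
qed

text \<open>The rate is \<open>\<delta> = 1 - cos (\<pi>/(r + 1))\<close>.\<close>

lemma sine_bump_rate:
  obtains \<delta> where "0 \<le> \<delta>" "\<delta> \<le> 5 / (real r + 1)\<^sup>2"
    and "\<And>n x. r \<le> n \<Longrightarrow> x \<in> {0..<int n} \<Longrightarrow>
      2 * (1 - \<delta>) * sine_bump r x \<le> sine_bump r ((x + 1) mod int n) + sine_bump r ((x - 1) mod int n)"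
proof
  show "0 \<le> 1 - cos (pi / (real r + 1))" by simp
  have "1 - cos (2 * pi * (1 / (2 * (real r + 1)))) \<le> 20 * (1 / (2 * (real r + 1)))\<^sup>2"
    by (rule one_minus_cos_le)
  also have "\<dots> = 5 / (real r + 1)\<^sup>2" by (simp add: power_divide power_mult_distrib del: distrib_left_numeral)
  also have "2 * pi * (1 / (2 * (real r + 1))) = pi / (real r + 1)" by (simp del: distrib_left_numeral)
  finally show "1 - cos (pi / (real r + 1)) \<le> 5 / (real r + 1)\<^sup>2" .
qed (use sine_bump_superharmonic in simp)

text \<open>The test function is a product of two bumps, supported in a square of side \<open>r\<close>.\<close>

lemma torus_profile_le_square:
  assumes "2 \<le> a" "a \<le> b" "1 \<le> r" "r \<le> a" "real r * real r \<le> v * (real a * real b)" "2 * (r * r) \<le> a * b"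
  shows "torus_profile a b v \<le> 10 / (real r + 1)\<^sup>2"
proof -
  obtain \<delta> where \<delta>: "0 \<le> \<delta>" "\<delta> \<le> 5 / (real r + 1)\<^sup>2"
    and super: "\<And>n x. r \<le> n \<Longrightarrow> x \<in> {0..<int n} \<Longrightarrow>
      2 * (1 - \<delta>) * sine_bump r x \<le> sine_bump r ((x + 1) mod int n) + sine_bump r ((x - 1) mod int n)"
    using sine_bump_rate[of r] by blast
  have "real (2 * (r * r)) \<le> real (a * b)" using assms(6) by (simp only: of_nat_le_iff)
  then have "torus_profile a b v \<le> 2 * \<delta>"
    using assms sine_bump_nonneg
    by (intro torus_profile_product_le[where g = "sine_bump r" and h = "sine_bump r"
          and A = "{0..<int r}" and B = "{0..<int r}" and xz = 0 and yz = 0] super sine_bump_0)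
       (auto simp: sine_bump_outside)
  then show ?thesis using \<delta> by simp
qed

text \<open>The test function is constant along the short side and a bump of length \<open>r\<close> along the long side.\<close>

lemma torus_profile_le_strip:
  assumes "2 \<le> a" "a \<le> b" "1 \<le> r" "2 * r \<le> b" "real r \<le> v * real b"
  shows "torus_profile a b v \<le> 10 / (real r + 1)\<^sup>2"
proof -
  obtain \<delta> where \<delta>: "0 \<le> \<delta>" "\<delta> \<le> 5 / (real r + 1)\<^sup>2"
    and super: "\<And>n x. r \<le> n \<Longrightarrow> x \<in> {0..<int n} \<Longrightarrow>
      2 * (1 - \<delta>) * sine_bump r x \<le> sine_bump r ((x + 1) mod int n) + sine_bump r ((x - 1) mod int n)"
    using sine_bump_rate[of r] by blast
  have "real a * real r \<le> real a * (v * real b)" "real a * (2 * real r) \<le> real a * real b"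
    using assms by (intro mult_left_mono; simp)+
  then have "torus_profile a b v \<le> 2 * \<delta>"
    using assms sine_bump_nonneg \<delta>(1)
    by (intro torus_profile_product_le[where g = "\<lambda>_. 1" and h = "sine_bump r"
          and A = "{0..<int a}" and B = "{0..<int r}" and xz = 0 and yz = 0] super sine_bump_0)
       (auto simp: sine_bump_outside mult_ac)
  then show ?thesis using \<delta> by simp
qed

section \<open>The spectral profile up to constants\<close>

lemma inverse_square_le:
  fixes x y :: real
  assumes "0 < y" "y \<le> 2 * x"
  shows "10 / x\<^sup>2 \<le> 40 * (1 / y\<^sup>2)"
proof -
  have "y\<^sup>2 \<le> (2 * x)\<^sup>2" using assms by (intro power_mono) auto
  then have "40 / (2 * x)\<^sup>2 \<le> 40 / y\<^sup>2" using assms by (intro divide_left_mono) auto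
  then show ?thesis by (simp add: power_mult_distrib)
qed

lemma nat_floor_bounds:
  fixes x :: real
  assumes "x \<ge> 0"
  shows "real (nat \<lfloor>x\<rfloor>) \<le> x" "x < real (nat \<lfloor>x\<rfloor>) + 1"
  using assms by linarith+

text \<open>For a set of volume \<open>v \<le> a/b\<close> the scale is the side \<open>\<rho> = \<surd>(v a b) \<le> a\<close> of a square with that
  volume. Up to volume \<open>1/64\<close> this square is small compared with the long side and
  \<open>torus_profile_ge_scale\<close> applies; beyond it \<open>a\<close>, \<open>b\<close> and \<open>\<rho>\<close> are comparable and the spectral gap
  gives the bound.\<close>

lemma torus_profile_small_volume:
  "comparable_on {(a, b, v). 2 \<le> a \<and> a \<le> b \<and> 1 / (real a * real b) \<le> v \<and> v \<le> real a / real b}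
     (\<lambda>(a, b, v). torus_profile a b v) (\<lambda>(a, b, v). 1 / (v * real a * real b))"
proof -
  have "torus_profile a b v \<le> 40 * (1 / (v * real a * real b))
      \<and> 1 / (v * real a * real b) \<le> 8192 * torus_profile a b v"
    if "2 \<le> a" "a \<le> b" "1 / (real a * real b) \<le> v" "v \<le> real a / real b" for a b v
  proof
    have b: "b \<ge> 2" using that by simp
    define \<rho> where "\<rho> = sqrt (v * real a * real b)"
    have vab: "1 \<le> v * real a * real b" using that b by (simp add: field_simps)
    have vb: "v * real b \<le> real a" using that b by (simp add: field_simps)
    have v0: "v > 0" using vab b that by (simp add: zero_less_mult_iff) (smt (verit) zero_less_mult_iff of_nat_0_less_iff mult_nonpos_nonneg of_nat_0_le_iff)
    have \<rho>2: "\<rho>\<^sup>2 = v * real a * real b" using vab by (simp add: \<rho>_def)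
    have \<rho>1: "\<rho> \<ge> 1" using vab by (simp add: \<rho>_def)
    have "v * real b * real a \<le> real a * real a" using vb by (intro mult_right_mono) auto
    then have \<rho>a: "\<rho> \<le> real a"
      unfolding \<rho>_def by (intro real_le_lsqrt) (auto simp: power2_eq_square mult_ac)
    \<comment> \<open>Halving \<open>\<rho>\<close> keeps the mass of the square at most \<open>1/2\<close>; the maximum handles \<open>\<rho> < 2\<close>, where
      a single point is the test set.\<close>
    define r where "r = max 1 (nat \<lfloor>\<rho> / 2\<rfloor>)"
    have r1: "r \<ge> 1" by (simp add: r_def)
    define m where "m = nat \<lfloor>\<rho> / 2\<rfloor>"
    have m: "r = max 1 m" "real m \<le> \<rho> / 2" "\<rho> / 2 < real m + 1"
      using nat_floor_bounds[of "\<rho> / 2"] \<rho>1 by (simp_all add: r_def m_def)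
    have "real m \<le> real r" by (simp add: m(1))
    then have r2: "\<rho> \<le> 2 * (real r + 1)" using m(3) by (simp add: field_simps)
    have r3: "r = 1 \<or> real r \<le> \<rho> / 2" using m(2) by (auto simp: m(1) max_def)
    have ra: "r \<le> a" using r3 \<rho>a that by auto
    have rr: "real r * real r \<le> \<rho>\<^sup>2"
      using r3
    proof
      assume "r = 1"
      then show ?thesis using vab \<rho>2 by simp
    next
      assume "real r \<le> \<rho> / 2"
      then have "real r * real r \<le> \<rho> * \<rho>" using \<rho>1 by (intro mult_mono) auto
      then show ?thesis by (simp add: power2_eq_square)
    qed
    have half: "2 * (r * r) \<le> a * b"
      using r3
    proof
      assume "r = 1"
      moreover have "2 * 2 \<le> a * b" using that b by (intro mult_mono) auto
      ultimately show ?thesis by simp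
    next
      assume "real r \<le> \<rho> / 2"
      then have "2 * real r \<le> real a" using \<rho>a by simp
      then have "2 * r \<le> a" by linarith
      then have "(2 * r) * r \<le> a * b" using ra that by (intro mult_mono) auto
      then show ?thesis by simp
    qed
    have "torus_profile a b v \<le> 10 / (real r + 1)\<^sup>2"
      using that r1 ra rr half \<rho>2 by (intro torus_profile_le_square) (auto simp: mult_ac)
    also have "\<dots> \<le> 40 * (1 / \<rho>\<^sup>2)" using \<rho>1 r2 by (intro inverse_square_le) auto
    finally show "torus_profile a b v \<le> 40 * (1 / (v * real a * real b))" by (simp add: \<rho>2)
    show "1 / (v * real a * real b) \<le> 8192 * torus_profile a b v"
    proof (cases "v \<le> 1 / 64")
      case True
      have "\<rho>\<^sup>2 \<le> (real b / 8)\<^sup>2"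
      proof -
        have "v * (real a * real b) \<le> 1 / 64 * (real b * real b)"
          using True v0 that by (intro mult_mono) auto
        then have "\<rho>\<^sup>2 \<le> 1 / 64 * (real b * real b)" by (simp only: \<rho>2 mult.assoc)
        then show ?thesis by (simp add: power2_eq_square)
      qed
      then have \<rho>b: "\<rho> \<le> real b / 8" by (rule power2_le_imp_le) simp
      have "(1 + real a / (8 * \<rho>)) * (1 + real b / (8 * \<rho>)) * v
          = (\<rho> / real a + 1 / 8) * (\<rho> / real b + 1 / 8)"
      proof -
        have "v = (\<rho> / real a) * (\<rho> / real b)"
          using \<rho>2 that b by (simp add: power2_eq_square field_simps)
        then have "(1 + real a / (8 * \<rho>)) * (1 + real b / (8 * \<rho>)) * v
            = ((1 + real a / (8 * \<rho>)) * (\<rho> / real a)) * ((1 + real b / (8 * \<rho>)) * (\<rho> / real b))"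
          by (simp only: mult_ac)
        also have "(1 + real a / (8 * \<rho>)) * (\<rho> / real a) = \<rho> / real a + 1 / 8"
          using \<rho>1 that by (simp add: field_simps)
        also have "(1 + real b / (8 * \<rho>)) * (\<rho> / real b) = \<rho> / real b + 1 / 8"
          using \<rho>1 b by (simp add: field_simps)
        finally show ?thesis .
      qed
      also have "\<dots> \<le> (1 + 1 / 8) * (1 / 8 + 1 / 8)"
        using \<rho>a \<rho>b \<rho>1 that b by (intro mult_mono add_right_mono) (auto simp: field_simps)
      also have "\<dots> \<le> 1 / 2" by simp
      finally have "1 / (8192 * \<rho>\<^sup>2) \<le> torus_profile a b v"
        using that \<rho>1 by (intro torus_profile_ge_scale) auto
      then show ?thesis by (simp add: \<rho>2)
    next
      case False
      have "1 / 64 * real b \<le> v * real b" using False by (intro mult_right_mono) auto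
      then have "real b \<le> 64 * (v * real b)" "real b \<le> 64 * real a" using vb by linarith+
      then have "real b * real b \<le> (64 * real a) * (64 * (v * real b))"
        by (intro mult_mono) auto
      then have "1 / (v * real a * real b) \<le> 4096 * (1 / (real b)\<^sup>2)"
        using vab b by (simp add: power2_eq_square field_simps)
      moreover have "0 \<le> 1 / (real b)\<^sup>2" by simp
      ultimately show ?thesis using torus_profile_ge_gap[OF that(1-3)] by linarith
    qed
  qed
  then show ?thesis
    unfolding comparable_on_def preceq_on_def
    by (intro conjI exI[of _ 40] exI[of _ 8192]) auto
qed

text \<open>A set of volume \<open>v \<ge> a/b\<close> can wrap around the short side, and the scale becomes the length
  \<open>\<rho> = v b \<ge> a\<close> of a strip with that volume.\<close>

lemma torus_profile_large_volume:
  "comparable_on {(a, b, v). 2 \<le> a \<and> a \<le> b \<and> real a / real b \<le> v \<and> v \<le> 1}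
     (\<lambda>(a, b, v). torus_profile a b v) (\<lambda>(a, b, v). 1 / (v\<^sup>2 * (real b)\<^sup>2))"
proof -
  have "torus_profile a b v \<le> 40 * (1 / (v\<^sup>2 * (real b)\<^sup>2))
      \<and> 1 / (v\<^sup>2 * (real b)\<^sup>2) \<le> 8192 * torus_profile a b v"
    if "2 \<le> a" "a \<le> b" "real a / real b \<le> v" "v \<le> 1" for a b v
  proof
    have b: "b \<ge> 2" using that by simp
    define \<rho> where "\<rho> = v * real b"
    have \<rho>a: "real a \<le> \<rho>" using that b by (simp add: \<rho>_def field_simps)
    have \<rho>b: "\<rho> \<le> real b" using that mult_right_mono[of v 1 "real b"] by (simp add: \<rho>_def)
    have \<rho>2: "\<rho> \<ge> 2" using \<rho>a that by simp
    have v0: "v > 0" using \<rho>2 b by (simp add: \<rho>_def zero_less_mult_iff) (smt (verit) mult_nonpos_nonneg of_nat_0_le_iff)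
    have vab: "1 / (real a * real b) \<le> v"
    proof -
      have "1 * 1 \<le> real a * \<rho>" using that \<rho>2 by (intro mult_mono) auto
      then show ?thesis using that b by (simp add: \<rho>_def field_simps)
    qed
    define r where "r = nat \<lfloor>\<rho> / 2\<rfloor>"
    have floor: "real r \<le> \<rho> / 2" "\<rho> / 2 < real r + 1"
      using nat_floor_bounds[of "\<rho> / 2"] \<rho>2 by (simp_all add: r_def)
    then have r: "1 \<le> r" "\<rho> \<le> 2 * (real r + 1)" "2 * real r \<le> \<rho>"
      using \<rho>2 by (auto simp: field_simps)
    have "2 * r \<le> b" using r(3) \<rho>b by linarith
    then have "torus_profile a b v \<le> 10 / (real r + 1)\<^sup>2"
      using that r \<rho>2 by (intro torus_profile_le_strip) (auto simp: \<rho>_def)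
    also have "\<dots> \<le> 40 * (1 / \<rho>\<^sup>2)" using \<rho>2 r by (intro inverse_square_le) auto
    finally show "torus_profile a b v \<le> 40 * (1 / (v\<^sup>2 * (real b)\<^sup>2))"
      by (simp add: \<rho>_def power_mult_distrib)
    show "1 / (v\<^sup>2 * (real b)\<^sup>2) \<le> 8192 * torus_profile a b v"
    proof (cases "v \<le> 1 / 64")
      case True
      have "(1 + real a / (8 * \<rho>)) * (1 + real b / (8 * \<rho>)) * v
          = (1 + real a / (8 * \<rho>)) * (v + 1 / 8)"
        using v0 b by (simp add: \<rho>_def field_simps)
      also have "\<dots> \<le> (1 + 1 / 8) * (1 / 64 + 1 / 8)"
        using \<rho>a \<rho>2 v0 True by (intro mult_mono add_right_mono add_left_mono) (auto simp: field_simps)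
      also have "\<dots> \<le> 1 / 2" by simp
      finally have "1 / (8192 * \<rho>\<^sup>2) \<le> torus_profile a b v"
        using that \<rho>2 vab by (intro torus_profile_ge_scale) auto
      then show ?thesis by (simp add: \<rho>_def power_mult_distrib)
    next
      case False
      then have "(1 / 64)\<^sup>2 \<le> v\<^sup>2" by (intro power_mono) auto
      then have "1 / v\<^sup>2 \<le> 1 / (1 / 64)\<^sup>2" using v0 by (intro divide_left_mono) auto
      then have "1 / v\<^sup>2 * (1 / (real b)\<^sup>2) \<le> 4096 * (1 / (real b)\<^sup>2)"
        by (intro mult_right_mono) (auto simp: power_divide)
      then have "1 / (v\<^sup>2 * (real b)\<^sup>2) \<le> 4096 * (1 / (real b)\<^sup>2)" by simp
      moreover have "0 \<le> 1 / (real b)\<^sup>2" by simp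
      ultimately show ?thesis using torus_profile_ge_gap[OF that(1,2) vab] by linarith
    qed
  qed
  then show ?thesis
    unfolding comparable_on_def preceq_on_def
    by (intro conjI exI[of _ 40] exI[of _ 8192]) auto
qed

text \<open>From volume \<open>1\<close> on there is no constraint on the support, and the profile is of the order of the
  spectral gap. A strip of half the length of the torus already attains it.\<close>

lemma torus_profile_full_volume:
  "comparable_on {(a, b, v). 2 \<le> a \<and> a \<le> b \<and> 1 \<le> v}
     (\<lambda>(a, b, v). torus_profile a b v) (\<lambda>(a, b, v). 1 / (real b)\<^sup>2)"
proof -
  have "torus_profile a b v \<le> 40 * (1 / (real b)\<^sup>2) \<and> 1 / (real b)\<^sup>2 \<le> 1 * torus_profile a b v"
    if "2 \<le> a" "a \<le> b" "1 \<le> v" for a b v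
  proof
    have b: "b \<ge> 2" using that by simp
    define r where "r = b div 2"
    have r: "1 \<le> r" "2 * r \<le> b" "b \<le> 2 * (r + 1)" using b unfolding r_def by presburger+
    have "1 * real b \<le> v * real b" using that by (intro mult_right_mono) auto
    then have "real r \<le> v * real b" using r(2) by linarith
    then have "torus_profile a b v \<le> 10 / (real r + 1)\<^sup>2"
      using that r by (intro torus_profile_le_strip) auto
    also have "\<dots> \<le> 40 * (1 / (real b)\<^sup>2)" using r b by (intro inverse_square_le) auto
    finally show "torus_profile a b v \<le> 40 * (1 / (real b)\<^sup>2)" .
    have "1 * 1 \<le> real a * real b" using that b by (intro mult_mono) auto
    then have "1 / (real a * real b) \<le> v" using that by (intro order_trans[OF _ that(3)]) simp
    then show "1 / (real b)\<^sup>2 \<le> 1 * torus_profile a b v"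
      using torus_profile_ge_gap that by simp
  qed
  then show ?thesis
    unfolding comparable_on_def preceq_on_def
    by (intro conjI exI[of _ 40] exI[of _ 1]) auto
qed

theorem lemma4p6:
  shows
    "comparable_on {(a, b, v). 2 \<le> a \<and> a \<le> b \<and> 1 / (real a * real b) \<le> v \<and> v \<le> real a / real b}
       (\<lambda>(a, b, v). torus_profile a b v) (\<lambda>(a, b, v). 1 / (v * real a * real b)) \<and>
     comparable_on {(a, b, v). 2 \<le> a \<and> a \<le> b \<and> real a / real b \<le> v \<and> v \<le> 1}
       (\<lambda>(a, b, v). torus_profile a b v) (\<lambda>(a, b, v). 1 / (v\<^sup>2 * (real b)\<^sup>2)) \<and>
     comparable_on {(a, b, v). 2 \<le> a \<and> a \<le> b \<and> 1 \<le> v}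
       (\<lambda>(a, b, v). torus_profile a b v) (\<lambda>(a, b, v). 1 / (real b)\<^sup>2) \<and>
     comparable_on {(a, b, t). 2 \<le> a \<and> a \<le> b \<and> 0 \<le> t \<and> t \<le> (real a)\<^sup>2}
       (\<lambda>(a, b, t). torus_dist a b t) (\<lambda>(a, b, t). real a * real b / (t + 1)) \<and>
     comparable_on {(a, b, t). 2 \<le> a \<and> a \<le> b \<and> (real a)\<^sup>2 \<le> t \<and> t \<le> (real b)\<^sup>2}
       (\<lambda>(a, b, t). torus_dist a b t) (\<lambda>(a, b, t). real b / sqrt t) \<and>
     (\<exists>c1>0. \<exists>c2>0.
       preceq_on {(a, b, t). 2 \<le> a \<and> a \<le> b \<and> (real b)\<^sup>2 \<le> t}
         (\<lambda>(a, b, t). exp (- c1 * t / (real b)\<^sup>2)) (\<lambda>(a, b, t). torus_dist a b t) \<and>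
       preceq_on {(a, b, t). 2 \<le> a \<and> a \<le> b \<and> (real b)\<^sup>2 \<le> t}
         (\<lambda>(a, b, t). torus_dist a b t) (\<lambda>(a, b, t). exp (- c2 * t / (real b)\<^sup>2)))"
  by (intro conjI exI[of _ 20] exI[of _ "1 / 3"] torus_profile_small_volume
      torus_profile_large_volume torus_profile_full_volume torus_dist_short_time
      torus_dist_medium_time torus_dist_long_time) simp_all

end
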